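(* Let $(V,g)$ be an $n$-dimensional Euclidean vector space, let $1\leq p\leq n$ be an integer, let $k$ be a real number with $1\leq k\leq\binom{n}{2}$, and let $\kappa\in\mathbb{R}$. The following are equivalent: (a) Every algebraic curvature operator $\mathcal{R}\in\operatorname{Sym}^2_B(\Lambda^2V)$ whose eigenvalues satisfy $\lambda_1+\ldots+\lambda_{\lfloor k\rfloor}+(k-\lfloor k\rfloor)\lambda_{\lfloor k\rfloor+1}\geq k\kappa$ satisfies $g(\operatorname{Ric}_L(\omega),\omega)\geq\kappa\,p(n-p)|\omega|^2$ for all $\omega\in\Lambda^pV^*$. (b) For every $\omega\in\Lambda^pV^*$ there exists $\eta\in\Lambda^4V^*$ such that $$0\leq\mathcal{A}_\omega+\hat\eta\leq\frac{\operatorname{tr}(\mathcal{A}_\omega+\hat\eta)}{k}\operatorname{id}_{\Lambda^2V}=\frac{p(n-p)}{k}|\omega|^2\operatorname{id}_{\Lambda^2V}.$$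
   Context: $\Lambda^2V$ is identified with $\mathfrak{so}(V)$ via $(x\wedge y)z=g(x,z)y-g(y,z)x$. If $e_1,\ldots,e_n$ is an orthonormal basis of $V$, then $\{e_{i_1}\wedge\ldots\wedge e_{i_p}\}_{i_1<\ldots<i_p}$ is orthonormal in $\Lambda^pV$, and likewise for the dual basis in $\Lambda^pV^*$. An element $\Xi\in\mathfrak{so}(V)$ acts on a $(0,p)$-tensor by $(\Xi\omega)(X_1,\ldots,X_p)=-\sum_{i=1}^p\omega(X_1,\ldots,\Xi X_i,\ldots,X_p)$. For $\omega\in\Lambda^pV^*$ the action operator $\mathcal{A}_\omega\colon\Lambda^2V\to\Lambda^2V$ is defined by $g(\mathcal{A}_\omega(\alpha),\beta)=g(\alpha\omega,\beta\omega)$. For $\eta\in\Lambda^4V^*$, $\hat\eta\colon\Lambda^2V\to\Lambda^2V$ is defined by $g(\hat\eta(x\wedge y),z\wedge w)=\eta(x,y,z,w)$. $\operatorname{Sym}^2(\Lambda^2V)$ is the space of self-adjoint operators on $\Lambda^2V$ and $\operatorname{Sym}^2_B(\Lambda^2V)$ is the subspace of algebraic curvature operators (those satisfying the first Bianchi identity), which is the orthogonal complement of $\widehat{\Lambda^4V^*}=\{\hat\eta:\eta\in\Lambda^4V^*\}$. Eigenvalues are ordered $\lambda_1\leq\ldots\leq\lambda_{\binom n2}$ (the term with coefficient $k-\lfloor k\rfloor$ is omitted if $k$ is an integer). For $\mathcal{R}\in\operatorname{Sym}^2_B(\Lambda^2V)$, put $R(X,Y)=\mathcal{R}(X\wedge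 Y)\in\mathfrak{so}(V)$ and define $$(\operatorname{Ric}_L\omega)(X_1,\ldots,X_p)=\sum_{i=1}^p\sum_{j=1}^n(R(X_i,e_j)\omega)(X_1,\ldots,e_j,\ldots,X_p),$$ with $e_j$ in the $i$-th slot. Equivalently, $g(\operatorname{Ric}_L(\omega),\omega)=\sum_\alpha\lambda_\alpha|\Xi_\alpha\omega|^2$ for an orthonormal eigenbasis $\{\Xi_\alpha\}$ of $\mathcal{R}$ with eigenvalues $\{\lambda_\alpha\}$. Inequalities between self-adjoint operators are in the sense of quadratic forms. *)

theory Defs
  imports "HOL-Analysis.Analysis"
begin

section \<open>Bivectors\<close>

text \<open>
  The second exterior power of \<open>V\<close> is identified with the space of skew-adjoint endomorphisms of
  \<open>V\<close>; \<open>wedge x y\<close> below is the skew endomorphism \<open>z \<mapsto> g(x,z) y - g(y,z) x\<close>.  This is not an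
  instance of \<^class>\<open>euclidean_space\<close>, because that class excludes the zero space, which occurs
  when \<open>V\<close> is one-dimensional.
\<close>

typedef (overloaded) ('a::euclidean_space) so =
  "{A :: 'a \<Rightarrow> 'a. linear A \<and> (\<forall>x y. A x \<bullet> y = - (x \<bullet> A y))}"
  morphisms so_apply Abs_so
  by (rule exI[of _ "\<lambda>x. 0"]) (auto intro: linear_zero)

setup_lifting type_definition_so

lemma linear_so_apply: "linear (so_apply A)"
  using so_apply[of A] by auto

lemma so_apply_skew: "so_apply A x \<bullet> y = - (x \<bullet> so_apply A y)"
  using so_apply[of A] by auto

lemma so_eqI: "(\<And>x. so_apply A x = so_apply B x) \<Longrightarrow> A = B"
  by (metis ext so_apply_inject)

instantiation so :: (euclidean_space) real_vector
begin

lift_definition zero_so :: "'a so" is "\<lambda>x. 0"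
  by (auto intro: linear_zero)

lift_definition plus_so :: "'a so \<Rightarrow> 'a so \<Rightarrow> 'a so" is "\<lambda>A B x. A x + B x"
  by (auto intro: linear_compose_add simp: inner_add_left inner_add_right)

lift_definition uminus_so :: "'a so \<Rightarrow> 'a so" is "\<lambda>A x. - A x"
  by (auto intro: linear_compose_neg)

lift_definition minus_so :: "'a so \<Rightarrow> 'a so \<Rightarrow> 'a so" is "\<lambda>A B x. A x - B x"
  by (auto intro: linear_compose_sub simp: inner_diff_left inner_diff_right)

lift_definition scaleR_so :: "real \<Rightarrow> 'a so \<Rightarrow> 'a so" is "\<lambda>c A x. c *\<^sub>R A x"
  by (auto intro: linear_compose_scale_right)

instance
proof
  fix A B C :: "'a so" and r s :: real
  show "A + B + C = A + (B + C)" by transfer (simp add: add.assoc)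
  show "A + B = B + A" by transfer (simp add: add.commute)
  show "0 + A = A" by transfer simp
  show "- A + A = 0" by transfer simp
  show "A - B = A + - B" by transfer simp
  show "r *\<^sub>R (A + B) = r *\<^sub>R A + r *\<^sub>R B" by transfer (simp add: scaleR_add_right)
  show "(r + s) *\<^sub>R A = r *\<^sub>R A + s *\<^sub>R A" by transfer (simp add: scaleR_add_left)
  show "r *\<^sub>R s *\<^sub>R A = (r * s) *\<^sub>R A" by transfer simp
  show "1 *\<^sub>R A = A" by transfer simp
qed

end

text \<open>
  The inner product of \<open>A\<close> and \<open>B\<close> is half the trace of the transpose of \<open>A\<close> times \<open>B\<close>; the factor
  one half makes \<open>e_i \<and> e_j\<close>, \<open>i < j\<close>, orthonormal (see \<open>inner_wedge_wedge\<close>).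
\<close>

instantiation so :: (euclidean_space) real_inner
begin

definition inner_so :: "'a so \<Rightarrow> 'a so \<Rightarrow> real"
  where "inner_so A B = (\<Sum>e\<in>Basis. so_apply A e \<bullet> so_apply B e) / 2"

definition norm_so :: "'a so \<Rightarrow> real"
  where "norm_so A = sqrt (inner A A)"

definition sgn_so :: "'a so \<Rightarrow> 'a so"
  where "sgn_so A = A /\<^sub>R norm A"

definition dist_so :: "'a so \<Rightarrow> 'a so \<Rightarrow> real"
  where "dist_so A B = norm (A - B)"

definition uniformity_so :: "('a so \<times> 'a so) filter"
  where "uniformity_so = (INF e\<in>{0<..}. principal {(x, y). dist x y < e})"

definition open_so :: "'a so set \<Rightarrow> bool"
  where "open_so U = (\<forall>x\<in>U. \<forall>\<^sub>F (x', y) in uniformity. x' = x \<longrightarrow> y \<in> U)"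

instance
proof
  fix A B C :: "'a so" and r :: real
  show "A \<bullet> B = B \<bullet> A" by (simp add: inner_so_def inner_commute)
  show "(A + B) \<bullet> C = A \<bullet> C + B \<bullet> C"
    by (simp add: inner_so_def plus_so.rep_eq inner_add_left sum.distrib add_divide_distrib)
  show "r *\<^sub>R A \<bullet> B = r * (A \<bullet> B)"
    by (simp add: inner_so_def scaleR_so.rep_eq sum_distrib_left)
  show "0 \<le> A \<bullet> A" by (simp add: inner_so_def sum_nonneg)
  show "(A \<bullet> A = 0) = (A = 0)"
  proof
    assume "A \<bullet> A = 0"
    then have "\<forall>e\<in>Basis. so_apply A e = 0"
      by (simp add: inner_so_def sum_nonneg_eq_0_iff)
    then have "so_apply A x = so_apply 0 x" for x
      using linear_eq_stdbasis[OF linear_so_apply linear_so_apply, of A 0]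
      by (simp add: zero_so.rep_eq)
    then show "A = 0" by (rule so_eqI)
  qed (simp add: inner_so_def zero_so.rep_eq)
qed (simp_all add: norm_so_def sgn_so_def dist_so_def uniformity_so_def open_so_def)

end

lift_definition wedge :: "'a::euclidean_space \<Rightarrow> 'a \<Rightarrow> 'a so"
  is "\<lambda>x y z. (x \<bullet> z) *\<^sub>R y - (y \<bullet> z) *\<^sub>R x"
  by (auto intro!: linearI
      simp: inner_add_right algebra_simps inner_diff_left inner_diff_right inner_commute)

lemma so_apply_expand: "(\<Sum>e\<in>Basis. (u \<bullet> e) *\<^sub>R so_apply A e) = so_apply A u"
proof -
  have "so_apply A u = so_apply A (\<Sum>e\<in>Basis. (u \<bullet> e) *\<^sub>R e)"
    by (simp only: euclidean_representation)
  then show ?thesis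
    by (simp only: linear_sum[OF linear_so_apply] linear_scale[OF linear_so_apply])
qed

lemma inner_so_wedge: "A \<bullet> wedge x y = so_apply A x \<bullet> y"
proof -
  have "A \<bullet> wedge x y = (\<Sum>e\<in>Basis. ((x \<bullet> e) *\<^sub>R so_apply A e) \<bullet> y - ((y \<bullet> e) *\<^sub>R so_apply A e) \<bullet> x) / 2"
    by (simp add: inner_so_def wedge.rep_eq inner_diff_right)
  also have "\<dots> = (so_apply A x \<bullet> y - so_apply A y \<bullet> x) / 2"
    by (simp only: sum_subtractf inner_sum_left[symmetric] so_apply_expand)
  also have "\<dots> = so_apply A x \<bullet> y"
    using so_apply_skew[of A y x] by (simp add: inner_commute)
  finally show ?thesis .
qed

lemma inner_wedge_wedge:
  "wedge x y \<bullet> wedge z w = (x \<bullet> z) * (y \<bullet> w) - (y \<bullet> z) * (x \<bullet> w)"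
  by (simp add: inner_so_wedge wedge.rep_eq inner_diff_left)

lemma so_expand:
  fixes A :: "'a::euclidean_space so"
  shows "A = (1/2) *\<^sub>R (\<Sum>a\<in>Basis. \<Sum>b\<in>Basis. (A \<bullet> wedge a b) *\<^sub>R wedge a b)"
proof (rule so_eqI)
  fix z
  have ap_add: "so_apply (\<Sum>i\<in>S. f i) z = (\<Sum>i\<in>S. so_apply (f i) z)" for S :: "'a set" and f :: "'a \<Rightarrow> 'a so"
    by (induction S rule: infinite_finite_induct) (auto simp: plus_so.rep_eq zero_so.rep_eq)
  have 1: "(\<Sum>a\<in>Basis. (a \<bullet> z) *\<^sub>R so_apply A a) = so_apply A z"
    using so_apply_expand[of z A] by (simp add: inner_commute)
  have "(\<Sum>a\<in>Basis. \<Sum>b\<in>Basis. (so_apply A a \<bullet> b) *\<^sub>R ((a \<bullet> z) *\<^sub>R b - (b \<bullet> z) *\<^sub>R a))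
    = (\<Sum>a\<in>Basis. (a \<bullet> z) *\<^sub>R (\<Sum>b\<in>Basis. (so_apply A a \<bullet> b) *\<^sub>R b))
    - (\<Sum>a\<in>Basis. \<Sum>b\<in>Basis. (so_apply A a \<bullet> b) *\<^sub>R (b \<bullet> z) *\<^sub>R a)"
    by (simp add: scaleR_diff_right sum_subtractf scaleR_sum_right mult.commute)
  also have "(\<Sum>a\<in>Basis. \<Sum>b\<in>Basis. (so_apply A a \<bullet> b) *\<^sub>R (b \<bullet> z) *\<^sub>R a)
    = (\<Sum>b\<in>Basis. (b \<bullet> z) *\<^sub>R (\<Sum>a\<in>Basis. (so_apply A a \<bullet> b) *\<^sub>R a))"
    by (subst sum.swap) (simp add: scaleR_sum_right mult.commute)
  also have "\<dots> = - (\<Sum>b\<in>Basis. (b \<bullet> z) *\<^sub>R (\<Sum>a\<in>Basis. (so_apply A b \<bullet> a) *\<^sub>R a))"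
  proof -
    have "(so_apply A a \<bullet> b) *\<^sub>R a = - ((so_apply A b \<bullet> a) *\<^sub>R a)" for a b
      using so_apply_skew[of A a b] by (simp add: inner_commute)
    then have "(\<Sum>a\<in>Basis. (so_apply A a \<bullet> b) *\<^sub>R a) = - (\<Sum>a\<in>Basis. (so_apply A b \<bullet> a) *\<^sub>R a)" for b
      by (simp only: sum_negf)
    then show ?thesis by (simp only: sum_negf scaleR_minus_right)
  qed
  finally have "(\<Sum>a\<in>Basis. \<Sum>b\<in>Basis. (so_apply A a \<bullet> b) *\<^sub>R ((a \<bullet> z) *\<^sub>R b - (b \<bullet> z) *\<^sub>R a))
    = so_apply A z + so_apply A z"
    by (simp only: euclidean_representation 1 diff_minus_eq_add)
  then show "so_apply A z
    = so_apply ((1/2) *\<^sub>R (\<Sum>a\<in>Basis. \<Sum>b\<in>Basis. (A \<bullet> wedge a b) *\<^sub>R wedge a b)) z"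
    by (simp only: scaleR_so.rep_eq ap_add inner_so_wedge wedge.rep_eq) (simp flip: scaleR_2)
qed

lemma so_riesz:
  fixes f :: "'a::euclidean_space so \<Rightarrow> real"
  assumes "linear f"
  shows "\<exists>!\<gamma>. \<forall>\<beta>. \<gamma> \<bullet> \<beta> = f \<beta>"
proof -
  let ?g = "(1/2) *\<^sub>R (\<Sum>a\<in>Basis. \<Sum>b\<in>Basis. f (wedge a b) *\<^sub>R (wedge a b :: 'a so))"
  have "?g \<bullet> \<beta> = f \<beta>" for \<beta>
  proof -
    have "f \<beta> = f ((1/2) *\<^sub>R (\<Sum>a\<in>Basis. \<Sum>b\<in>Basis. (\<beta> \<bullet> wedge a b) *\<^sub>R wedge a b))"
      by (subst so_expand[of \<beta>]) simp
    also have "\<dots> = ?g \<bullet> \<beta>"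
      by (simp add: linear_scale[OF assms] linear_sum[OF assms] inner_sum_left
          inner_commute[of \<beta>] mult.commute)
    finally show ?thesis by simp
  qed
  moreover have "\<gamma> = ?g" if "\<forall>\<beta>. \<gamma> \<bullet> \<beta> = f \<beta>" for \<gamma>
    using that calculation vector_eq_rdot[of \<gamma> ?g] by simp
  ultimately show ?thesis by blast
qed

section \<open>Operators on bivectors\<close>

definition sym2 :: "('a::euclidean_space so \<Rightarrow> 'a so) set"
  where "sym2 = {T. linear T \<and> (\<forall>\<alpha> \<beta>. T \<alpha> \<bullet> \<beta> = \<alpha> \<bullet> T \<beta>)}"

definition alg_curvature_operators :: "('a::euclidean_space so \<Rightarrow> 'a so) set"
  where "alg_curvature_operators =
    {\<R> \<in> sym2. \<forall>x y z. so_apply (\<R> (wedge x y)) z + so_apply (\<R> (wedge y z)) x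
                       + so_apply (\<R> (wedge z x)) y = 0}"

definition op_le :: "('a::euclidean_space so \<Rightarrow> 'a so) \<Rightarrow> ('a so \<Rightarrow> 'a so) \<Rightarrow> bool"
  where "op_le S T \<longleftrightarrow> (\<forall>\<alpha>. S \<alpha> \<bullet> \<alpha> \<le> T \<alpha> \<bullet> \<alpha>)"

text \<open>
  The factor one half compensates for summing over all ordered pairs of basis vectors;
  \<open>so_trace_orthonormal\<close> shows independence of the basis.
\<close>

definition so_trace :: "('a::euclidean_space so \<Rightarrow> 'a so) \<Rightarrow> real"
  where "so_trace T = (\<Sum>a\<in>Basis. \<Sum>b\<in>Basis. T (wedge a b) \<bullet> wedge a b) / 2"

lemma so_trace_orthonormal:
  fixes T :: "'a::euclidean_space so \<Rightarrow> 'a so"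
  assumes T: "linear T" and B: "finite B" "span B = UNIV"
    and on: "\<And>b c. b \<in> B \<Longrightarrow> c \<in> B \<Longrightarrow> b \<bullet> c = (if b = c then 1 else 0)"
  shows "so_trace T = (\<Sum>b\<in>B. T b \<bullet> b)"
proof -
  have exp: "(\<Sum>c\<in>B. (x \<bullet> c) *\<^sub>R c) = x" for x
  proof -
    have "x \<in> span B" using B by simp
    then obtain u where u: "x = (\<Sum>c\<in>B. u c *\<^sub>R c)"
      using B by (auto simp: span_finite)
    have "x \<bullet> c = u c" if "c \<in> B" for c
    proof -
      have "x \<bullet> c = (\<Sum>d\<in>B. if d = c then u d else 0)"
        unfolding u inner_sum_left by (rule sum.cong) (auto simp: on that)
      then show ?thesis using that B by simp
    qed
    then show ?thesis using u by simp
  qed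
  have "(\<Sum>b\<in>B. T b \<bullet> b)
      = (\<Sum>b\<in>B. \<Sum>x\<in>Basis. \<Sum>y\<in>Basis. (b \<bullet> wedge x y) * (T (wedge x y) \<bullet> b) / 2)"
  proof (rule sum.cong[OF refl])
    fix b assume "b \<in> B"
    have "T b \<bullet> b = T ((1/2) *\<^sub>R (\<Sum>x\<in>Basis. \<Sum>y\<in>Basis. (b \<bullet> wedge x y) *\<^sub>R wedge x y)) \<bullet> b"
      by (subst so_expand[of b, symmetric]) simp
    then show "T b \<bullet> b = (\<Sum>x\<in>Basis. \<Sum>y\<in>Basis. (b \<bullet> wedge x y) * (T (wedge x y) \<bullet> b) / 2)"
      by (simp add: linear_scale[OF T] linear_sum[OF T] inner_sum_left sum_divide_distrib)
  qed
  also have "\<dots> = (\<Sum>x\<in>Basis. \<Sum>y\<in>Basis. \<Sum>b\<in>B. (b \<bullet> wedge x y) * (T (wedge x y) \<bullet> b) / 2)"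
    by (subst sum.swap) (simp add: sum.swap[of _ B])
  also have "\<dots> = (\<Sum>x\<in>Basis. \<Sum>y\<in>Basis. T (wedge x y) \<bullet> wedge x y / 2)"
  proof (intro sum.cong refl)
    fix x y :: 'a
    have "T (wedge x y) \<bullet> wedge x y = T (wedge x y) \<bullet> (\<Sum>b\<in>B. (wedge x y \<bullet> b) *\<^sub>R b)"
      by (simp add: exp)
    then show "(\<Sum>b\<in>B. (b \<bullet> wedge x y) * (T (wedge x y) \<bullet> b) / 2) = T (wedge x y) \<bullet> wedge x y / 2"
      by (simp add: inner_sum_right sum_divide_distrib inner_commute mult.commute)
  qed
  finally show ?thesis by (simp add: so_trace_def sum_divide_distrib)
qed

text \<open>
  The increasing list of eigenvalues, each repeated according to the dimension of its eigenspace.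
  The list is indexed from \<open>0\<close>, so the \<open>i\<close>-th smallest eigenvalue is entry \<open>i - 1\<close>.
\<close>

definition eigenvalue_list :: "('a::euclidean_space so \<Rightarrow> 'a so) \<Rightarrow> real list"
  where "eigenvalue_list T =
    concat (map (\<lambda>\<mu>. replicate (dim {\<alpha>. T \<alpha> = \<mu> *\<^sub>R \<alpha>}) \<mu>)
      (sorted_list_of_set {\<mu>. \<exists>\<alpha>. \<alpha> \<noteq> 0 \<and> T \<alpha> = \<mu> *\<^sub>R \<alpha>}))"

definition lowest_eigenvalue_sum :: "real \<Rightarrow> ('a::euclidean_space so \<Rightarrow> 'a so) \<Rightarrow> real"
  where "lowest_eigenvalue_sum k T =
    (\<Sum>i<nat \<lfloor>k\<rfloor>. eigenvalue_list T ! i)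
    + (if k \<in> \<int> then 0 else (k - of_int \<lfloor>k\<rfloor>) * eigenvalue_list T ! nat \<lfloor>k\<rfloor>)"

section \<open>Exterior forms\<close>

text \<open>
  A \<open>p\<close>-tuple of vectors is represented by a sequence of which only the entries with index below
  \<open>p\<close> matter; the first condition makes this representation of \<open>p\<close>-forms unique.
\<close>

definition forms :: "nat \<Rightarrow> ((nat \<Rightarrow> 'a::euclidean_space) \<Rightarrow> real) set"
  where "forms p = {\<omega>.
    (\<forall>X Y. (\<forall>i<p. X i = Y i) \<longrightarrow> \<omega> X = \<omega> Y) \<and>
    (\<forall>i<p. \<forall>X. linear (\<lambda>v. \<omega> (X(i := v)))) \<and>
    (\<forall>X. \<forall>i<p. \<forall>j<p. i \<noteq> j \<longrightarrow> X i = X j \<longrightarrow> \<omega> X = 0)}"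

text \<open>
  The inner product for which the forms \<open>e^{i_1} \<and> \<dots> \<and> e^{i_p}\<close>, \<open>i_1 < \<dots> < i_p\<close>, are
  orthonormal: the sum of \<open>\<omega>(e_{i_1}, \<dots>, e_{i_p}) \<zeta>(e_{i_1}, \<dots>, e_{i_p})\<close> over increasing
  indices, written as a sum over all \<open>p\<close>-tuples of basis vectors divided by \<open>p!\<close>
  (see \<open>form_inner_increasing\<close>).
\<close>

definition form_inner ::
  "nat \<Rightarrow> ((nat \<Rightarrow> 'a::euclidean_space) \<Rightarrow> real) \<Rightarrow> ((nat \<Rightarrow> 'a) \<Rightarrow> real) \<Rightarrow> real"
  where "form_inner p \<omega> \<zeta> = (\<Sum>X \<in> {..<p} \<rightarrow>\<^sub>E Basis. \<omega> X * \<zeta> X) / fact p"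

lemma forms_cong:
  assumes "\<omega> \<in> forms p" and eq: "\<And>i. i < p \<Longrightarrow> X i = Y i"
  shows "\<omega> X = \<omega> Y"
proof -
  have H: "\<forall>X Y. (\<forall>i<p. X i = Y i) \<longrightarrow> \<omega> X = \<omega> Y"
    using assms(1) unfolding forms_def mem_Collect_eq by (rule conjunct1)
  show ?thesis by (rule H[rule_format]) (rule eq)
qed

lemma forms_linear: "\<omega> \<in> forms p \<Longrightarrow> i < p \<Longrightarrow> linear (\<lambda>v. \<omega> (X(i := v)))"
  unfolding forms_def mem_Collect_eq by (elim conjE) (simp only: simp_thms)

lemma forms_alternating:
  "\<omega> \<in> forms p \<Longrightarrow> i < p \<Longrightarrow> j < p \<Longrightarrow> i \<noteq> j \<Longrightarrow> X i = X j \<Longrightarrow> \<omega> X = 0"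
  unfolding forms_def mem_Collect_eq by (elim conjE) (metis (no_types))

lemma forms_swap:
  assumes \<omega>: "\<omega> \<in> forms p" and ij: "i < p" "j < p" "i \<noteq> j"
  shows "\<omega> (X \<circ> Transposition.transpose i j) = - \<omega> X"
proof -
  define F where "F u v = \<omega> (X(i := u, j := v))" for u v
  have lin: "linear (\<lambda>v. \<omega> (Y(m := v)))" if "m < p" for Y m
    using \<omega> that by (rule forms_linear)
  have zero: "\<omega> Y = 0" if "Y i = Y j" for Y
    using \<omega> ij that by (rule forms_alternating)
  have tw: "X(i := u, j := v) = X(j := v, i := u)" for u v
    by (rule fun_upd_twist) (rule ij)
  have l1: "linear (\<lambda>u. F u v)" for v
    unfolding F_def tw by (rule lin) (rule ij)
  have l2: "linear (F u)" for u
    unfolding F_def by (rule lin) (rule ij)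
  have alt: "F u u = 0" for u
    unfolding F_def by (rule zero) (use ij in simp)
  have "F (X i + X j) (X i + X j) = F (X i) (X i) + F (X i) (X j) + (F (X j) (X i) + F (X j) (X j))"
    by (simp only: linear_add[OF l1] linear_add[OF l2] ac_simps)
  then have "F (X j) (X i) = - F (X i) (X j)" by (simp add: alt)
  moreover have "X \<circ> Transposition.transpose i j = X(i := X j, j := X i)"
    by (rule ext) (use ij in \<open>auto simp: Transposition.transpose_def\<close>)
  ultimately show ?thesis by (simp add: F_def)
qed

lemma forms_permute:
  assumes \<omega>: "\<omega> \<in> forms p" and \<pi>: "\<pi> permutes {..<p}"
  shows "\<omega> (X \<circ> \<pi>) = of_int (sign \<pi>) * \<omega> X"
proof -
  have "\<forall>X. \<omega> (X \<circ> \<pi>) = of_int (sign \<pi>) * \<omega> X"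
    using \<pi> finite_lessThan
  proof (induction rule: permutes_induct)
    case id
    then show ?case by (simp add: sign_id)
  next
    case (swap a b q)
    let ?t = "Transposition.transpose a b"
    have ab: "a < p" "b < p" using swap by auto
    have "permutation q" using permutes_imp_permutation[OF finite_lessThan] swap by blast
    then have sgn: "sign (?t \<circ> q) = - sign q"
      using swap(3) by (simp add: sign_compose permutation_swap_id sign_swap_id)
    have "\<omega> (X \<circ> (?t \<circ> q)) = of_int (sign (?t \<circ> q)) * \<omega> X" for X
    proof -
      have "\<omega> ((X \<circ> ?t) \<circ> q) = of_int (sign q) * \<omega> (X \<circ> ?t)" using swap by blast
      also have "\<omega> (X \<circ> ?t) = - \<omega> X" by (rule forms_swap[OF \<omega> ab swap(3)])
      finally show ?thesis
        by (simp only: sgn comp_assoc of_int_minus mult_minus_left mult_minus_right)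
    qed
    then show ?case by blast
  qed
  then show ?thesis by blast
qed

lemma form_inner_increasing:
  fixes e :: "nat \<Rightarrow> 'a::euclidean_space"
  assumes \<omega>: "\<omega> \<in> forms p" and \<zeta>: "\<zeta> \<in> forms p"
    and e: "bij_betw e {..<DIM('a)} Basis"
  shows "form_inner p \<omega> \<zeta> =
    (\<Sum>I | I \<subseteq> {..<DIM('a)} \<and> card I = p.
      \<omega> (\<lambda>i. e (sorted_list_of_set I ! i)) * \<zeta> (\<lambda>i. e (sorted_list_of_set I ! i)))"
proof -
  let ?n = "DIM('a)"
  let ?s = "\<lambda>I i. e (sorted_list_of_set I ! i)"
  let ?h = "\<lambda>X. \<omega> X * \<zeta> X"
  let ?P = "{..<p} \<rightarrow>\<^sub>E (Basis :: 'a set)"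
  let ?J = "{X \<in> ?P. inj_on X {..<p}}"
  let ?S = "{I. I \<subseteq> {..<?n} \<and> card I = p}"
  have hcong: "?h X = ?h Y" if "\<And>i. i < p \<Longrightarrow> X i = Y i" for X Y
  proof -
    have "\<omega> X = \<omega> Y" "\<zeta> X = \<zeta> Y"
      by (rule forms_cong[OF \<omega>], erule that) (rule forms_cong[OF \<zeta>], erule that)
    then show ?thesis by simp
  qed
  have h0: "?h X = 0" if ni: "\<not> inj_on X {..<p}" for X
  proof -
    obtain i j where "i < p" "j < p" "i \<noteq> j" "X i = X j"
      using ni by (auto simp: inj_on_def)
    then have "\<omega> X = 0" by (rule forms_alternating[OF \<omega>])
    then show ?thesis by simp
  qed
  have hperm: "?h (X \<circ> \<pi>) = ?h X" if "\<pi> permutes {..<p}" for X \<pi>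
  proof -
    have "(of_int (sign \<pi>) :: real) * of_int (sign \<pi>) = 1"
      by (simp flip: of_int_mult)
    then show ?thesis
      unfolding forms_permute[OF \<omega> that] forms_permute[OF \<zeta> that] by algebra
  qed
  have finP: "finite ?P" by (intro finite_PiE) auto
  define T where "T = (SIGMA I:?S. {\<pi>. \<pi> permutes {..<p}})"
  define \<Phi> where "\<Phi> = (\<lambda>(I, \<pi>). restrict (?s I \<circ> \<pi>) {..<p})"
  have sl: "bij_betw (\<lambda>i. sorted_list_of_set I ! i) {..<p} I" if "I \<in> ?S" for I
  proof -
    have "finite I" using that finite_subset by auto
    then show ?thesis using that
      by (intro bij_betw_nth) auto
  qed
  have sb: "bij_betw (?s I) {..<p} (e ` I)" if "I \<in> ?S" for I
  proof -
    have "bij_betw e I (e ` I)" using that bij_betw_subset[OF e] by auto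
    from bij_betw_trans[OF sl[OF that] this] show ?thesis by (simp add: comp_def)
  qed
  have img: "\<Phi> (I, \<pi>) ` {..<p} = e ` I" if "I \<in> ?S" "\<pi> permutes {..<p}" for I \<pi>
    using bij_betw_trans[OF permutes_imp_bij[OF that(2)] sb[OF that(1)]]
    by (simp add: \<Phi>_def bij_betw_def)
  have bij: "bij_betw \<Phi> T ?J"
  proof (rule bij_betwI')
    fix x y assume x: "x \<in> T" and y: "y \<in> T"
    obtain I \<pi> K \<sigma> where [simp]: "x = (I, \<pi>)" "y = (K, \<sigma>)" by (cases x, cases y)
    have I: "I \<in> ?S" "\<pi> permutes {..<p}" and K: "K \<in> ?S" "\<sigma> permutes {..<p}"
      using x y by (auto simp: T_def)
    show "(\<Phi> x = \<Phi> y) = (x = y)"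
    proof
      assume eq: "\<Phi> x = \<Phi> y"
      then have "e ` I = e ` K" using img[OF I] img[OF K] by simp
      then have IK: "I = K"
        using I K bij_betw_imp_inj_on[OF e] by (auto simp: inj_on_image_eq_iff)
      have "\<pi> i = \<sigma> i" for i
      proof (cases "i < p")
        case True
        have "?s I (\<pi> i) = ?s I (\<sigma> i)"
          using fun_cong[OF eq, of i] True IK by (simp add: \<Phi>_def)
        moreover have "\<pi> i < p" "\<sigma> i < p"
          using True permutes_in_image[OF I(2), of i] permutes_in_image[OF K(2), of i] by auto
        ultimately show ?thesis
          using bij_betw_imp_inj_on[OF sb[OF I(1)]] by (auto dest: inj_onD)
      next
        case False
        then show ?thesis using I(2) K(2) by (simp add: permutes_not_in)
      qed
      then show "x = y" using IK by auto
    qed simp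
  next
    fix x assume x: "x \<in> T"
    obtain I \<pi> where [simp]: "x = (I, \<pi>)" by (cases x)
    have I: "I \<in> ?S" "\<pi> permutes {..<p}" using x by (auto simp: T_def)
    have b: "bij_betw (?s I \<circ> \<pi>) {..<p} (e ` I)"
      using bij_betw_trans[OF permutes_imp_bij[OF I(2)] sb[OF I(1)]] .
    have "e ` I \<subseteq> Basis" using I e by (auto simp: bij_betw_def)
    then have "?s I (\<pi> i) \<in> Basis" if "i < p" for i
      using bij_betw_apply[OF b, of i] that by auto
    then show "\<Phi> x \<in> ?J"
      using bij_betw_imp_inj_on[OF b] by (simp add: \<Phi>_def inj_on_def)
  next
    fix X assume X: "X \<in> ?J"
    define I where "I = the_inv_into {..<?n} e ` X ` {..<p}"
    have inv: "bij_betw (the_inv_into {..<?n} e) Basis {..<?n}"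
      by (rule bij_betw_the_inv_into[OF e])
    have sub: "X ` {..<p} \<subseteq> Basis" using X by auto
    have Isub: "I \<subseteq> {..<?n}" using inv sub by (auto simp: I_def bij_betw_def)
    have "inj_on (the_inv_into {..<?n} e) (X ` {..<p})"
      using bij_betw_imp_inj_on[OF inv] sub by (rule inj_on_subset)
    then have "card I = card (X ` {..<p})" unfolding I_def by (rule card_image)
    also have "\<dots> = card {..<p}" using X by (intro card_image) simp
    finally have "card I = p" by simp
    with Isub have I: "I \<in> ?S" by simp
    have "e (the_inv_into {..<?n} e v) = v" if "v \<in> X ` {..<p}" for v
      using e sub that by (intro f_the_inv_into_f) (auto simp: bij_betw_def)
    then have eI: "e ` I = X ` {..<p}"
      unfolding I_def image_image[of e] by simp
    define \<pi> where "\<pi> = (\<lambda>i. if i < p then the_inv_into {..<p} (?s I) (X i) else i)"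
    have b1: "bij_betw X {..<p} (e ` I)" using X eI by (auto simp: bij_betw_def)
    have b2: "bij_betw (the_inv_into {..<p} (?s I)) (e ` I) {..<p}"
      by (rule bij_betw_the_inv_into[OF sb[OF I]])
    have "bij_betw (the_inv_into {..<p} (?s I) \<circ> X) {..<p} {..<p}"
      by (rule bij_betw_trans[OF b1 b2])
    then have "bij_betw \<pi> {..<p} {..<p}"
      by (rule bij_betw_cong[THEN iffD1, rotated]) (simp add: \<pi>_def)
    then have \<pi>: "\<pi> permutes {..<p}"
      by (rule bij_imp_permutes) (simp add: \<pi>_def)
    have "\<Phi> (I, \<pi>) = X"
    proof
      fix i
      show "\<Phi> (I, \<pi>) i = X i"
      proof (cases "i < p")
        case True
        have "X i \<in> e ` I" using True eI by auto
        then have "?s I (the_inv_into {..<p} (?s I) (X i)) = X i"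
          using sb[OF I] by (intro f_the_inv_into_f) (auto simp: bij_betw_def)
        then show ?thesis using True by (simp add: \<Phi>_def \<pi>_def)
      next
        case False
        then show ?thesis using X by (auto simp: \<Phi>_def PiE_def extensional_def)
      qed
    qed
    then show "\<exists>x\<in>T. X = \<Phi> x" using I \<pi> by (auto simp: T_def intro!: bexI[of _ "(I, \<pi>)"])
  qed
  have "(\<Sum>X\<in>?P. ?h X) = (\<Sum>X\<in>?J. ?h X)"
    using h0 finP by (intro sum.mono_neutral_right) auto
  also have "\<dots> = (\<Sum>x\<in>T. ?h (\<Phi> x))"
    by (rule sum.reindex_bij_betw[OF bij, symmetric])
  also have "\<dots> = (\<Sum>(I, \<pi>)\<in>T. ?h (?s I))"
  proof (intro sum.cong refl)
    fix x assume x: "x \<in> T"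
    obtain I \<pi> where [simp]: "x = (I, \<pi>)" by (cases x)
    have "?h (\<Phi> x) = ?h (?s I \<circ> \<pi>)" by (rule hcong) (simp add: \<Phi>_def)
    also have "\<dots> = ?h (?s I)" by (rule hperm) (use x in \<open>simp add: T_def\<close>)
    finally show "?h (\<Phi> x) = (case x of (I, \<pi>) \<Rightarrow> ?h (?s I))" by simp
  qed
  also have "\<dots> = (\<Sum>I\<in>?S. \<Sum>\<pi> | \<pi> permutes {..<p}. ?h (?s I))"
    unfolding T_def by (rule sum.Sigma[symmetric]) (auto simp: finite_permutations)
  also have "\<dots> = fact p * (\<Sum>I\<in>?S. ?h (?s I))"
    by (simp add: card_permutations[OF card_lessThan] sum_distrib_left)
  finally show ?thesis by (simp add: form_inner_def)
qed

definition so_act ::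
  "nat \<Rightarrow> 'a::euclidean_space so \<Rightarrow> ((nat \<Rightarrow> 'a) \<Rightarrow> real) \<Rightarrow> (nat \<Rightarrow> 'a) \<Rightarrow> real"
  where "so_act p \<Xi> \<omega> X = - (\<Sum>i<p. \<omega> (X(i := so_apply \<Xi> (X i))))"

definition action_op ::
  "nat \<Rightarrow> ((nat \<Rightarrow> 'a::euclidean_space) \<Rightarrow> real) \<Rightarrow> 'a so \<Rightarrow> 'a so"
  where "action_op p \<omega> \<alpha> = (THE \<gamma>. \<forall>\<beta>. \<gamma> \<bullet> \<beta> = form_inner p (so_act p \<alpha> \<omega>) (so_act p \<beta> \<omega>))"

lemma linear_so_act:
  assumes "\<omega> \<in> forms p"
  shows "linear (\<lambda>\<Xi>. so_act p \<Xi> \<omega> X)"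
proof (rule linearI)
  have l: "linear (\<lambda>v. \<omega> (X(i := v)))" if "i < p" for i
    using assms that by (rule forms_linear)
  show "so_act p (A + B) \<omega> X = so_act p A \<omega> X + so_act p B \<omega> X" for A B
    by (simp add: so_act_def plus_so.rep_eq linear_add[OF l] sum.distrib)
  show "so_act p (c *\<^sub>R A) \<omega> X = c *\<^sub>R so_act p A \<omega> X" for c A
    by (simp add: so_act_def scaleR_so.rep_eq linear_scale[OF l] sum_distrib_left)
qed

lemma inner_action_op:
  assumes "\<omega> \<in> forms p"
  shows "action_op p \<omega> \<alpha> \<bullet> \<beta> = form_inner p (so_act p \<alpha> \<omega>) (so_act p \<beta> \<omega>)"
proof -
  have "linear (\<lambda>\<beta>. form_inner p (so_act p \<alpha> \<omega>) (so_act p \<beta> \<omega>))"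
    by (rule linearI)
      (simp_all add: form_inner_def linear_add[OF linear_so_act[OF assms]]
        linear_scale[OF linear_so_act[OF assms]] algebra_simps sum.distrib add_divide_distrib
        sum_distrib_left)
  from theI'[OF so_riesz[OF this]] show ?thesis
    unfolding action_op_def by blast
qed

text \<open>\<open>\<eta>(x, y, z, w)\<close> is \<open>\<eta> ((!) [x, y, z, w])\<close>.\<close>

definition hat :: "((nat \<Rightarrow> 'a::euclidean_space) \<Rightarrow> real) \<Rightarrow> 'a so \<Rightarrow> 'a so"
  where "hat \<eta> = (THE T. linear T \<and>
    (\<forall>x y z w. T (wedge x y) \<bullet> wedge z w = \<eta> ((!) [x, y, z, w])))"

lemma wedge_expand_bilinear:
  fixes B :: "'a::euclidean_space \<Rightarrow> 'a \<Rightarrow> real"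
  assumes l: "\<And>y. linear (\<lambda>x. B x y)" and r: "\<And>x. linear (B x)" and alt: "\<And>x. B x x = 0"
  shows "(\<Sum>a\<in>Basis. \<Sum>b\<in>Basis. (wedge x y \<bullet> wedge a b) * B a b) = 2 * B x y"
proof -
  have *: "(\<Sum>a\<in>Basis. \<Sum>b\<in>Basis. ((u \<bullet> a) * (v \<bullet> b)) * B a b) = B u v" for u v
  proof -
    have 1: "B a v = (\<Sum>b\<in>Basis. (v \<bullet> b) * B a b)" for a
    proof -
      have "B a v = B a (\<Sum>b\<in>Basis. (v \<bullet> b) *\<^sub>R b)"
        by (simp only: euclidean_representation)
      then show ?thesis
        by (simp only: linear_sum[OF r] linear_scale[OF r] real_scaleR_def)
    qed
    have "B u v = B (\<Sum>a\<in>Basis. (u \<bullet> a) *\<^sub>R a) v"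
      by (simp only: euclidean_representation)
    also have "\<dots> = (\<Sum>a\<in>Basis. (u \<bullet> a) * B a v)"
      by (simp only: linear_sum[OF l] linear_scale[OF l] real_scaleR_def)
    also have "\<dots> = (\<Sum>a\<in>Basis. (u \<bullet> a) * (\<Sum>b\<in>Basis. (v \<bullet> b) * B a b))"
      by (intro sum.cong refl arg_cong2[of _ _ _ _ "(*)"] 1)
    finally show ?thesis by (simp add: sum_distrib_left mult.assoc)
  qed
  have "B (x + y) (x + y) = B x x + B x y + B y x + B y y"
    by (simp add: linear_add[OF l] linear_add[OF r])
  then have "B y x = - B x y" by (simp add: alt)
  then show ?thesis
    using *[of x y] *[of y x]
    by (simp add: inner_wedge_wedge left_diff_distrib sum_subtractf)
qed

lemma hat_ex1:
  fixes \<eta> :: "(nat \<Rightarrow> 'a::euclidean_space) \<Rightarrow> real"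
  assumes \<eta>: "\<eta> \<in> forms 4"
  shows "\<exists>!T. linear T \<and> (\<forall>x y z w. T (wedge x y) \<bullet> wedge z w = \<eta> ((!) [x, y, z, w]))"
proof -
  let ?N = "\<lambda>x y z w. \<eta> ((!) [x, y, z, w])"
  have upd: "linear (\<lambda>v. \<eta> (((!) [x, y, z, w])(i := v)))" if "i < 4" for i x y z w
    using \<eta> that by (rule forms_linear)
  have cong: "\<eta> X = \<eta> Y" if "\<And>i. i < 4 \<Longrightarrow> X i = Y i" for X Y
    using \<eta> that by (rule forms_cong)
  have less4: "i < 4 \<Longrightarrow> i = 0 \<or> i = 1 \<or> i = 2 \<or> i = 3" for i :: nat by auto
  have e: "\<eta> (((!) [x, y, z, w])(0 := v)) = ?N v y z w"
       "\<eta> (((!) [x, y, z, w])(1 := v)) = ?N x v z w"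
       "\<eta> (((!) [x, y, z, w])(2 := v)) = ?N x y v w"
       "\<eta> (((!) [x, y, z, w])(3 := v)) = ?N x y z v" for x y z w v
    by (rule cong; drule less4; auto simp: numeral_3_eq_3 numeral_2_eq_2)+
  have lin: "linear (\<lambda>v. ?N v y z w)" "linear (\<lambda>v. ?N x v z w)"
       "linear (\<lambda>v. ?N x y v w)" "linear (\<lambda>v. ?N x y z v)" for x y z w
    using upd[of 0 x y z w] upd[of 1 x y z w] upd[of 2 x y z w] upd[of 3 x y z w]
    unfolding e by simp_all
  have alt0: "\<eta> X = 0" if "i < 4" "j < 4" "i \<noteq> j" "X i = X j" for X i j
    using \<eta> that by (rule forms_alternating)
  have alt: "?N x x z w = 0" "?N x y z z = 0" for x y z w
    using alt0[of 0 1 "(!) [x, x, z, w]"] alt0[of 2 3 "(!) [x, y, z, z]"]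
    by (simp_all add: numeral_3_eq_3 numeral_2_eq_2)
  let ?T = "\<lambda>\<alpha>. \<Sum>c\<in>Basis. \<Sum>d\<in>Basis. \<Sum>a\<in>Basis. \<Sum>b\<in>Basis.
    ((\<alpha> \<bullet> wedge a b) * ?N a b c d / 4) *\<^sub>R (wedge c d :: 'a so)"
  have "linear ?T"
    by (rule linearI)
      (simp_all add: inner_add_left algebra_simps add_divide_distrib scaleR_add_left
        sum.distrib scaleR_sum_right)
  moreover have "?T (wedge x y) \<bullet> wedge z w = ?N x y z w" for x y z w
  proof -
    have "?T (wedge x y) \<bullet> wedge z w = (\<Sum>c\<in>Basis. \<Sum>d\<in>Basis. (wedge z w \<bullet> wedge c d) *
        (\<Sum>a\<in>Basis. \<Sum>b\<in>Basis. (wedge x y \<bullet> wedge a b) * ?N a b c d)) / 4"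
      by (simp add: inner_sum_left sum_distrib_left sum_divide_distrib
          inner_commute[of "wedge z w"] mult_ac)
    also have "\<dots> = (\<Sum>c\<in>Basis. \<Sum>d\<in>Basis. (wedge z w \<bullet> wedge c d) * (2 * ?N x y c d)) / 4"
      by (subst wedge_expand_bilinear) (auto intro: lin alt)
    also have "\<dots> = 2 * (\<Sum>c\<in>Basis. \<Sum>d\<in>Basis. (wedge z w \<bullet> wedge c d) * ?N x y c d) / 4"
      by (simp add: sum_distrib_left mult_ac)
    also have "\<dots> = ?N x y z w"
      by (subst wedge_expand_bilinear) (auto intro: lin alt)
    finally show ?thesis .
  qed
  moreover have "S = T" if S: "linear S" and T: "linear T"
    and eq: "\<forall>x y z w. S (wedge x y) \<bullet> wedge z w = T (wedge x y) \<bullet> wedge z w"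
    for S T :: "'a so \<Rightarrow> 'a so"
  proof
    fix \<alpha> :: "'a so"
    have "S (wedge x y) = T (wedge x y)" for x y
      by (subst so_expand[of "S _"], subst so_expand[of "T _"]) (simp add: eq)
    then show "S \<alpha> = T \<alpha>"
      by (subst (1 2) so_expand[of \<alpha>])
        (simp add: linear_scale[OF S] linear_scale[OF T] linear_sum[OF S] linear_sum[OF T])
  qed
  ultimately show ?thesis
    by (intro ex1I[of _ ?T]) auto
qed

definition Ric_L ::
  "nat \<Rightarrow> ('a::euclidean_space so \<Rightarrow> 'a so) \<Rightarrow> ((nat \<Rightarrow> 'a) \<Rightarrow> real) \<Rightarrow> (nat \<Rightarrow> 'a) \<Rightarrow> real"
  where "Ric_L p \<R> \<omega> X =
    (\<Sum>i<p. \<Sum>e\<in>Basis. so_act p (\<R> (wedge (X i) e)) \<omega> (X(i := e)))"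

end

theory Submission
  imports Defs
begin

text \<open>
  Pairing operators by the trace, \<open>g(Ric_L \<omega>, \<omega>) = \<langle>\<R>, A_\<omega>\<rangle>\<close> and \<open>tr A_\<omega> = p (n - p) |\<omega>|\<^sup>2 =: t\<close>.
  The minimum of \<open>\<langle>\<R>, S\<rangle>\<close> over the compact convex set \<open>K\<close> of all \<open>S\<close> with \<open>0 \<le> S \<le> t/k\<close> and
  \<open>tr S = t\<close> is \<open>t/k\<close> times the sum of the \<open>k\<close> lowest eigenvalues of \<open>\<R>\<close>.  Since algebraic
  curvature operators are orthogonal to all \<open>hat \<eta>\<close>, (b) gives (a).  Conversely, if the affine
  space \<open>A_\<omega> + {hat \<eta>}\<close> misses \<open>K\<close>, a separating functional is constant on that affine space,
  hence represented by an algebraic curvature operator; adding a multiple of the identity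
  makes it violate (a).
\<close>

section \<open>Exterior forms and their moments\<close>

text \<open>The equivalence is proved for each \<omega> separately. Replacing \<R> by \<R> + d id
  raises the sum of the k lowest eigenvalues by k d and g(Ric_L \<omega>, \<omega>) by d t, so both
  inequalities in (a) move together and the eigenvalue sum can be normalised to exactly k \<kappa>.
  The bound t/k in K is the constant for which spreading total weight k over an eigenbasis gives
  trace t; K is nonempty because k \<le> n choose 2.

  Compactness of K makes the separation strict: K plus the subspace of all \<open>hat \<eta>\<close>
  is then closed. A functional bounded below on that sum must vanish on the subspace, and vanishing
  on every \<open>hat \<eta>\<close> is the Bianchi identity.

  The space \<open>so\<close> may be zero and comes without a chosen basis. Computations therefore
  use the redundant family \<open>wedge a b\<close> over ordered pairs of basis vectors, whence the
  factors 1/2 and 1/4; compactness of the unit sphere, and with it the spectral theorem, is also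
  derived from this family.\<close>

text \<open>
  The bivector representing the functional \<open>\<Xi> \<mapsto> (\<Xi> \<omega>)(Y)\<close>.  In these terms \<open>A_\<omega>\<close> is the sum
  of \<open>m \<otimes> m / p!\<close> over the moments \<open>m\<close> at all \<open>p\<close>-tuples \<open>Y\<close> of basis vectors.
\<close>

definition form_moment ::
  "nat \<Rightarrow> ((nat \<Rightarrow> 'a::euclidean_space) \<Rightarrow> real) \<Rightarrow> (nat \<Rightarrow> 'a) \<Rightarrow> 'a so"
  where "form_moment p \<omega> Y = (\<Sum>i<p. \<Sum>a\<in>Basis. \<omega> (Y(i := a)) *\<^sub>R wedge a (Y i))"

text \<open>By skewness \<open>wedge a (Y i)\<close> pairs with \<Xi> to -(\<Xi> Y_i \<bullet> a);
  summing over a reassembles \<Xi> Y_i in slot i, with the sign of the action on forms.\<close>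

lemma inner_form_moment:
  assumes "\<omega> \<in> forms p"
  shows "form_moment p \<omega> Y \<bullet> \<Xi> = so_act p \<Xi> \<omega> Y"
proof -
  have "(\<Sum>a\<in>Basis. \<omega> (Y(i := a)) * (wedge a (Y i) \<bullet> \<Xi>)) = - \<omega> (Y(i := so_apply \<Xi> (Y i)))"
    if i: "i < p" for i
  proof -
    note l = forms_linear[OF assms i, of Y]
    have "wedge a (Y i) \<bullet> \<Xi> = - (so_apply \<Xi> (Y i) \<bullet> a)" for a
      using inner_so_wedge[of \<Xi> a "Y i"] so_apply_skew[of \<Xi> a "Y i"]
      by (simp add: inner_commute)
    then have "(\<Sum>a\<in>Basis. \<omega> (Y(i := a)) * (wedge a (Y i) \<bullet> \<Xi>))
        = - (\<Sum>a\<in>Basis. (so_apply \<Xi> (Y i) \<bullet> a) * \<omega> (Y(i := a)))"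
      by (simp add: sum_negf mult.commute)
    also have "(\<Sum>a\<in>Basis. (so_apply \<Xi> (Y i) \<bullet> a) * \<omega> (Y(i := a)))
        = \<omega> (Y(i := (\<Sum>a\<in>Basis. (so_apply \<Xi> (Y i) \<bullet> a) *\<^sub>R a)))"
      by (simp only: linear_sum[OF l] linear_scale[OF l] real_scaleR_def)
    finally show ?thesis by (simp only: euclidean_representation)
  qed
  then show ?thesis
    by (simp add: form_moment_def so_act_def inner_sum_left flip: sum_negf)
qed

lemma inner_action_op_moment:
  assumes "\<omega> \<in> forms p"
  shows "action_op p \<omega> \<alpha> \<bullet> \<beta> =
    (\<Sum>Y\<in>{..<p} \<rightarrow>\<^sub>E Basis. (form_moment p \<omega> Y \<bullet> \<alpha>) * (form_moment p \<omega> Y \<bullet> \<beta>)) / fact p"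
  by (simp add: inner_action_op[OF assms] form_inner_def inner_form_moment[OF assms])

lemma sym2_linear: "T \<in> sym2 \<Longrightarrow> linear T"
  and sym2_inner: "T \<in> sym2 \<Longrightarrow> T \<alpha> \<bullet> \<beta> = \<alpha> \<bullet> T \<beta>"
  by (auto simp: sym2_def)

text \<open>Exchanging the entry in slot i with the extra summation vector is an involution on
  pairs. It moves the e_j of \<open>Ric_L\<close> out of slot i, so that all terms become values at
  one and the same tuple.\<close>

lemma sum_PiE_fun_upd_swap:
  fixes F :: "('i \<Rightarrow> 'a) \<Rightarrow> 'a \<Rightarrow> 'b::comm_monoid_add"
  assumes "i \<in> I"
  shows "(\<Sum>X\<in>I \<rightarrow>\<^sub>E B. \<Sum>e\<in>B. F X e) = (\<Sum>Y\<in>I \<rightarrow>\<^sub>E B. \<Sum>a\<in>B. F (Y(i := a)) (Y i))"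
  unfolding sum.cartesian_product
  by (rule sum.reindex_bij_witness[of _ "\<lambda>(Y, a). (Y(i := a), Y i)" "\<lambda>(Y, a). (Y(i := a), Y i)"])
    (use assms in \<open>auto simp: PiE_iff extensional_def\<close>)

text \<open>After the exchange, the sum over i and a of \<omega>(Y(i := a)) \<R>(a \<and> Y_i) is
  \<R> applied to the moment at Y, and acting on \<omega> at Y is pairing with that same
  moment.\<close>

lemma form_inner_Ric_L:
  assumes \<omega>: "\<omega> \<in> forms p" and R: "\<R> \<in> sym2"
  shows "form_inner p (Ric_L p \<R> \<omega>) \<omega> =
    (\<Sum>Y\<in>{..<p} \<rightarrow>\<^sub>E Basis. \<R> (form_moment p \<omega> Y) \<bullet> form_moment p \<omega> Y) / fact p"
proof -
  note lR = sym2_linear[OF R]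
  let ?P = "{..<p} \<rightarrow>\<^sub>E (Basis :: 'a set)"
  have "(\<Sum>X\<in>?P. Ric_L p \<R> \<omega> X * \<omega> X) = (\<Sum>i<p. \<Sum>X\<in>?P. \<Sum>e\<in>Basis.
      so_act p (\<R> (wedge (X i) e)) \<omega> (X(i := e)) * \<omega> X)"
    by (simp add: Ric_L_def sum_distrib_right sum.swap[of _ "{..<p}" ?P])
  also have "\<dots> = (\<Sum>i<p. \<Sum>Y\<in>?P. \<Sum>a\<in>Basis.
      so_act p (\<R> (wedge a (Y i))) \<omega> Y * \<omega> (Y(i := a)))"
    by (rule sum.cong[OF refl], rule trans[OF sum_PiE_fun_upd_swap]) auto
  also have "\<dots> = (\<Sum>Y\<in>?P. so_act p (\<R> (form_moment p \<omega> Y)) \<omega> Y)"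
    by (simp add: form_moment_def linear_sum[OF lR] linear_scale[OF lR]
        linear_sum[OF linear_so_act[OF \<omega>]] linear_scale[OF linear_so_act[OF \<omega>]]
        sum.swap[of _ "{..<p}" ?P] mult.commute)
  also have "\<dots> = (\<Sum>Y\<in>?P. \<R> (form_moment p \<omega> Y) \<bullet> form_moment p \<omega> Y)"
    by (simp add: inner_form_moment[OF \<omega>, symmetric] inner_commute)
  finally show ?thesis by (simp add: form_inner_def)
qed

text \<open>The p diagonal terms contribute 1 - n each and the p (p - 1) off-diagonal ones
  contribute 1 each; their total p (p - n) changes sign in the definition of the action.\<close>

lemma Ric_L_id:
  fixes \<omega> :: "(nat \<Rightarrow> 'a::euclidean_space) \<Rightarrow> real"
  assumes \<omega>: "\<omega> \<in> forms p"
  shows "Ric_L p (\<lambda>\<alpha>. \<alpha>) \<omega> X = real p * (real DIM('a) - real p) * \<omega> X"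
proof -
  define G where "G i j = (\<Sum>e\<in>Basis. \<omega> (X(i := e, j := so_apply (wedge (X i) e) ((X(i := e)) j))))"
    for i j
  have Gii: "G i i = (1 - real DIM('a)) * \<omega> X" if i: "i < p" for i
  proof -
    note l = forms_linear[OF \<omega> i, of X]
    have "G i i = \<omega> (X(i := (\<Sum>e\<in>Basis. (X i \<bullet> e) *\<^sub>R e - X i)))"
      by (simp only: G_def linear_sum[OF l] fun_upd_upd fun_upd_same wedge.rep_eq)
        (intro sum.cong refl, simp)
    also have "(\<Sum>e\<in>Basis. (X i \<bullet> e) *\<^sub>R e - X i) = (1 - real DIM('a)) *\<^sub>R X i"
      by (simp add: sum_subtractf euclidean_representation algebra_simps sum_constant_scaleR)
    finally show ?thesis by (simp only: linear_scale[OF l] fun_upd_triv real_scaleR_def)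
  qed
  \<comment> \<open>The bivector sends X_j to (X_i \<bullet> X_j) e - (e \<bullet> X_j) X_i. The
    first part puts e in both slots and dies; the second, summed over e, exchanges X_i and X_j, and
    its sign cancels that of the transposition.\<close>
  have Gij: "G i j = \<omega> X" if i: "i < p" and j: "j < p" and ij: "i \<noteq> j" for i j
  proof -
    have "\<omega> (X(i := e, j := so_apply (wedge (X i) e) ((X(i := e)) j)))
        = - ((X j \<bullet> e) * \<omega> (X(j := X i, i := e)))" for e
    proof -
      note l = forms_linear[OF \<omega> j, of "X(i := e)"]
      have "\<omega> (X(i := e, j := e)) = 0"
        using i j ij by (intro forms_alternating[OF \<omega> i j]) auto
      moreover have "\<omega> (X(i := e, j := (X i \<bullet> X j) *\<^sub>R e - (e \<bullet> X j) *\<^sub>R X i)) =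
          (X i \<bullet> X j) * \<omega> (X(i := e, j := e)) - (e \<bullet> X j) * \<omega> (X(i := e, j := X i))"
        by (simp only: linear_diff[OF l] linear_scale[OF l] real_scaleR_def)
      ultimately show ?thesis
        using ij by (simp add: wedge.rep_eq fun_upd_twist[OF ij] inner_commute)
    qed
    then have "G i j = - (\<Sum>e\<in>Basis. (X j \<bullet> e) * \<omega> (X(j := X i, i := e)))"
      by (simp add: G_def sum_negf)
    also have "(\<Sum>e\<in>Basis. (X j \<bullet> e) * \<omega> (X(j := X i, i := e)))
        = \<omega> (X(j := X i, i := (\<Sum>e\<in>Basis. (X j \<bullet> e) *\<^sub>R e)))"
    proof -
      note l = forms_linear[OF \<omega> i, of "X(j := X i)"]
      show ?thesis by (simp only: linear_sum[OF l] linear_scale[OF l] real_scaleR_def)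
    qed
    also have "\<dots> = \<omega> (X \<circ> Transposition.transpose i j)"
      unfolding euclidean_representation
      by (rule arg_cong[of _ _ \<omega>]) (use ij in \<open>auto simp: Transposition.transpose_def\<close>)
    also have "\<dots> = - \<omega> X" by (rule forms_swap[OF \<omega> i j ij])
    finally show ?thesis by simp
  qed
  have "Ric_L p (\<lambda>\<alpha>. \<alpha>) \<omega> X = - (\<Sum>i<p. \<Sum>j<p. G i j)"
    by (simp add: Ric_L_def so_act_def G_def sum_negf sum.swap[of _ "{..<p}" Basis])
  also have "(\<Sum>i<p. \<Sum>j<p. G i j) = (\<Sum>i<p. \<Sum>j<p. \<omega> X - (if i = j then real DIM('a) * \<omega> X else 0))"
    by (intro sum.cong refl) (auto simp: Gii Gij algebra_simps)
  also have "\<dots> = (\<Sum>i<p. real p * \<omega> X - real DIM('a) * \<omega> X)"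
    by (simp add: sum_subtractf)
  finally show ?thesis by (simp add: algebra_simps)
qed

lemma so_parseval:
  fixes \<alpha> \<beta> :: "'a::euclidean_space so"
  shows "\<alpha> \<bullet> \<beta> = (\<Sum>a\<in>Basis. \<Sum>b\<in>Basis. (\<alpha> \<bullet> wedge a b) * (\<beta> \<bullet> wedge a b)) / 2"
  by (subst so_expand[of \<alpha>]) (simp add: inner_sum_left inner_commute[of \<beta>])

lemma id_alg_curvature: "(\<lambda>\<alpha>. \<alpha>) \<in> alg_curvature_operators"
  by (auto simp: alg_curvature_operators_def sym2_def wedge.rep_eq linear_ident inner_commute)

text \<open>The trace of a sum of \<open>m \<otimes> m\<close> is the sum of the squared norms of
  the m, which is the Ricci term of the identity, the curvature operator of the round unit
  sphere.\<close>

lemma so_trace_action_op: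
  fixes \<omega> :: "(nat \<Rightarrow> 'a::euclidean_space) \<Rightarrow> real"
  assumes \<omega>: "\<omega> \<in> forms p"
  shows "so_trace (action_op p \<omega>) = real p * (real DIM('a) - real p) * form_inner p \<omega> \<omega>"
proof -
  let ?P = "{..<p} \<rightarrow>\<^sub>E (Basis :: 'a set)"
  let ?m = "form_moment p \<omega>"
  have "so_trace (action_op p \<omega>)
      = (\<Sum>a\<in>Basis. \<Sum>b\<in>Basis. \<Sum>Y\<in>?P. (?m Y \<bullet> wedge a b) * (?m Y \<bullet> wedge a b)) / 2 / fact p"
    by (simp add: so_trace_def inner_action_op_moment[OF \<omega>] sum_divide_distrib mult.commute[of 2])
  also have "(\<Sum>a\<in>Basis. \<Sum>b\<in>Basis. \<Sum>Y\<in>?P. (?m Y \<bullet> wedge a b) * (?m Y \<bullet> wedge a b))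
      = (\<Sum>Y\<in>?P. \<Sum>a\<in>Basis. \<Sum>b\<in>Basis. (?m Y \<bullet> wedge a b) * (?m Y \<bullet> wedge a b))"
    by (simp add: sum.swap[of _ Basis ?P])
  also have "\<dots> / 2 = (\<Sum>Y\<in>?P. ?m Y \<bullet> ?m Y)"
    unfolding so_parseval[of "?m Y" "?m Y" for Y] sum_divide_distrib ..
  also have "\<dots> / fact p = form_inner p (Ric_L p (\<lambda>\<alpha>. \<alpha>) \<omega>) \<omega>"
    using id_alg_curvature by (subst form_inner_Ric_L[OF \<omega>]) (auto simp: alg_curvature_operators_def)
  also have "\<dots> = real p * (real DIM('a) - real p) * form_inner p \<omega> \<omega>"
    by (simp add: form_inner_def Ric_L_id[OF \<omega>] sum_distrib_left mult.assoc)
  finally show ?thesis .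
qed

section \<open>Operators of four-forms and their orthogonality to curvature operators\<close>

lemma linear_hat: "\<eta> \<in> forms 4 \<Longrightarrow> linear (hat \<eta>)"
  and inner_hat_wedge: "\<eta> \<in> forms 4 \<Longrightarrow> hat \<eta> (wedge x y) \<bullet> wedge z w = \<eta> ((!) [x, y, z, w])"
  using theI'[OF hat_ex1, of \<eta>] unfolding hat_def by blast+

lemma so_functional_eqI:
  fixes f g :: "'a::euclidean_space so \<Rightarrow> 'b::real_vector"
  assumes f: "linear f" and g: "linear g"
    and eq: "\<And>a b. a \<in> Basis \<Longrightarrow> b \<in> Basis \<Longrightarrow> f (wedge a b) = g (wedge a b)"
  shows "f \<alpha> = g \<alpha>"
  by (subst (1 2) so_expand[of \<alpha>])
    (simp add: linear_scale[OF f] linear_scale[OF g] linear_sum[OF f] linear_sum[OF g] eq)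

lemma so_linear_eqI:
  fixes S T :: "'a::euclidean_space so \<Rightarrow> 'a so"
  assumes S: "linear S" and T: "linear T"
    and eq: "\<And>a b c d. a \<in> Basis \<Longrightarrow> b \<in> Basis \<Longrightarrow> c \<in> Basis \<Longrightarrow> d \<in> Basis \<Longrightarrow>
      S (wedge a b) \<bullet> wedge c d = T (wedge a b) \<bullet> wedge c d"
  shows "S = T"
proof
  fix \<alpha> :: "'a so"
  have "S (wedge x y) = T (wedge x y)" if "x \<in> Basis" "y \<in> Basis" for x y
    by (subst so_expand[of "S _"], subst so_expand[of "T _"]) (simp add: eq that)
  then show "S \<alpha> = T \<alpha>"
    by (subst (1 2) so_expand[of \<alpha>])
      (simp add: linear_scale[OF S] linear_scale[OF T] linear_sum[OF S] linear_sum[OF T])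
qed

lemma
  assumes \<eta>: "\<eta> \<in> forms 4"
  shows form4_swap12: "\<eta> ((!) [y, x, z, w]) = - \<eta> ((!) [x, y, z, w])"
    and form4_swap23: "\<eta> ((!) [x, z, y, w]) = - \<eta> ((!) [x, y, z, w])"
    and form4_swap34: "\<eta> ((!) [x, y, w, z]) = - \<eta> ((!) [x, y, z, w])"
proof -
  have less4: "i < 4 \<Longrightarrow> i = 0 \<or> i = 1 \<or> i = 2 \<or> i = 3" for i :: nat by auto
  have "\<eta> ((!) [y, x, z, w]) = \<eta> ((!) [x, y, z, w] \<circ> Transposition.transpose 0 1)"
    "\<eta> ((!) [x, z, y, w]) = \<eta> ((!) [x, y, z, w] \<circ> Transposition.transpose 1 2)"
    "\<eta> ((!) [x, y, w, z]) = \<eta> ((!) [x, y, z, w] \<circ> Transposition.transpose 2 3)"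
    by (rule forms_cong[OF \<eta>]; drule less4;
        auto simp: Transposition.transpose_def numeral_3_eq_3 numeral_2_eq_2)+
  then show "\<eta> ((!) [y, x, z, w]) = - \<eta> ((!) [x, y, z, w])"
    "\<eta> ((!) [x, z, y, w]) = - \<eta> ((!) [x, y, z, w])"
    "\<eta> ((!) [x, y, w, z]) = - \<eta> ((!) [x, y, z, w])"
    by (simp_all add: forms_swap[OF \<eta>])
qed

lemma hat_in_sym2:
  assumes \<eta>: "\<eta> \<in> forms 4"
  shows "hat \<eta> \<in> sym2"
proof -
  \<comment> \<open>Exchanging the two pairs is even: xyzw, xzyw, zxyw, zxwy, zwxy are four adjacent
    transpositions.\<close>
  have sw: "\<eta> ((!) [x, y, z, w]) = \<eta> ((!) [z, w, x, y])" for x y z w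
    using form4_swap23[OF \<eta>, where x = x and y = y and z = z and w = w]
      form4_swap12[OF \<eta>, where x = x and y = z and z = y and w = w]
      form4_swap34[OF \<eta>, where x = z and y = x and z = y and w = w]
      form4_swap23[OF \<eta>, where x = z and y = x and z = w and w = y] by linarith
  note lh = linear_hat[OF \<eta>]
  have "hat \<eta> \<alpha> \<bullet> \<beta> = \<alpha> \<bullet> hat \<eta> \<beta>" for \<alpha> \<beta>
  proof -
    have "hat \<eta> (wedge a b) \<bullet> \<beta> = wedge a b \<bullet> hat \<eta> \<beta>" for a b
    proof (rule so_functional_eqI[where f = "\<lambda>\<beta>. hat \<eta> (wedge a b) \<bullet> \<beta>"
          and g = "\<lambda>\<beta>. wedge a b \<bullet> hat \<eta> \<beta>"])
      show "hat \<eta> (wedge a b) \<bullet> wedge c d = wedge a b \<bullet> hat \<eta> (wedge c d)" for c d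
        by (simp add: inner_hat_wedge[OF \<eta>] inner_commute[of "wedge a b"] sw[of a b c d])
    qed (auto intro!: linearI simp: linear_add[OF lh] linear_scale[OF lh] inner_add_right)
    then show ?thesis
    proof (rule so_functional_eqI[where f = "\<lambda>\<alpha>. hat \<eta> \<alpha> \<bullet> \<beta>"
          and g = "\<lambda>\<alpha>. \<alpha> \<bullet> hat \<eta> \<beta>", rotated 2])
    qed (auto intro!: linearI simp: linear_add[OF lh] linear_scale[OF lh] inner_add_left)
  qed
  then show ?thesis using lh by (auto simp: sym2_def)
qed

text \<open>Hence the trace in (b) is that of \<open>action_op p \<omega>\<close>, whichever \<eta>
  is chosen.\<close>

lemma so_trace_hat:
  assumes \<eta>: "\<eta> \<in> forms 4"
  shows "so_trace (hat \<eta>) = 0"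
proof -
  have "\<eta> ((!) [a, b, a, b]) = 0" for a b
    by (rule forms_alternating[OF \<eta>, of 0 2]) simp_all
  then show ?thesis by (simp add: so_trace_def inner_hat_wedge[OF \<eta>])
qed

text \<open>A 3-cycle is even, so \<eta> is invariant under cycling its first three arguments.
  Relabelling the summation therefore cycles the arguments of \<R> instead, and the three copies of
  the sum add up to a Bianchi sum.\<close>

lemma so_trace_alg_curvature_hat:
  fixes \<R> :: "'a::euclidean_space so \<Rightarrow> 'a so"
  assumes \<eta>: "\<eta> \<in> forms 4" and R: "\<R> \<in> alg_curvature_operators"
  shows "so_trace (\<lambda>\<alpha>. \<R> (hat \<eta> \<alpha>)) = 0"
proof -
  define r where "r a b c d = \<R> (wedge a b) \<bullet> wedge c d" for a b c d
  define s where "s = (\<Sum>a\<in>Basis. \<Sum>b\<in>Basis. \<Sum>c\<in>Basis. \<Sum>d\<in>Basis. \<eta> ((!) [a, b, c, d]) * r a b c d)"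
  have R2: "\<R> \<in> sym2" using R by (simp add: alg_curvature_operators_def)
  have "so_trace (\<lambda>\<alpha>. \<R> (hat \<eta> \<alpha>)) = (\<Sum>a\<in>Basis. \<Sum>b\<in>Basis. hat \<eta> (wedge a b) \<bullet> \<R> (wedge a b)) / 2"
    by (simp add: so_trace_def sym2_inner[OF R2])
  \<comment> \<open>One factor 1/2 comes from the trace and one from Parseval, both taken over
    ordered pairs.\<close>
  also have "\<dots> = s / 4"
    by (simp add: so_parseval[of "hat \<eta> (wedge a b)" "\<R> (wedge a b)" for a b] inner_hat_wedge[OF \<eta>]
        s_def r_def flip: sum_divide_distrib)
  finally have t: "so_trace (\<lambda>\<alpha>. \<R> (hat \<eta> \<alpha>)) = s / 4" .
  have cyc: "\<eta> ((!) [b, c, a, d]) = \<eta> ((!) [a, b, c, d])" "\<eta> ((!) [c, a, b, d]) = \<eta> ((!) [a, b, c, d])" for a b c d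
    using form4_swap12[OF \<eta>, where x = a and y = b and z = c and w = d]
      form4_swap23[OF \<eta>, where x = b and y = a and z = c and w = d]
      form4_swap23[OF \<eta>, where x = a and y = b and z = c and w = d]
      form4_swap12[OF \<eta>, where x = a and y = c and z = b and w = d] by linarith+
  have bianchi: "r a b c d + r b c a d + r c a b d = 0" for a b c d
  proof -
    have "so_apply (\<R> (wedge a b)) c + so_apply (\<R> (wedge b c)) a + so_apply (\<R> (wedge c a)) b = 0"
      using R by (simp add: alg_curvature_operators_def)
    then have "(so_apply (\<R> (wedge a b)) c + so_apply (\<R> (wedge b c)) a + so_apply (\<R> (wedge c a)) b) \<bullet> d = 0"
      by simp
    then show ?thesis by (simp add: r_def inner_so_wedge inner_add_left)
  qed
  have s1: "s = (\<Sum>a\<in>Basis. \<Sum>b\<in>Basis. \<Sum>c\<in>Basis. \<Sum>d\<in>Basis. \<eta> ((!) [a, b, c, d]) * r b c a d)"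
  proof -
    have "s = (\<Sum>b\<in>Basis. \<Sum>c\<in>Basis. \<Sum>a\<in>Basis. \<Sum>d\<in>Basis. \<eta> ((!) [a, b, c, d]) * r b c a d)"
      by (unfold s_def, intro sum.cong refl arg_cong2[of _ _ _ _ "(*)"] cyc(1))
    also have "\<dots> = (\<Sum>b\<in>Basis. \<Sum>a\<in>Basis. \<Sum>c\<in>Basis. \<Sum>d\<in>Basis. \<eta> ((!) [a, b, c, d]) * r b c a d)"
      by (rule sum.cong[OF refl]) (rule sum.swap)
    also have "\<dots> = (\<Sum>a\<in>Basis. \<Sum>b\<in>Basis. \<Sum>c\<in>Basis. \<Sum>d\<in>Basis. \<eta> ((!) [a, b, c, d]) * r b c a d)"
      by (rule sum.swap)
    finally show ?thesis .
  qed
  have s2: "s = (\<Sum>a\<in>Basis. \<Sum>b\<in>Basis. \<Sum>c\<in>Basis. \<Sum>d\<in>Basis. \<eta> ((!) [a, b, c, d]) * r c a b d)"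
  proof -
    have "s = (\<Sum>c\<in>Basis. \<Sum>a\<in>Basis. \<Sum>b\<in>Basis. \<Sum>d\<in>Basis. \<eta> ((!) [a, b, c, d]) * r c a b d)"
      by (unfold s_def, intro sum.cong refl arg_cong2[of _ _ _ _ "(*)"] cyc(2))
    also have "\<dots> = (\<Sum>a\<in>Basis. \<Sum>c\<in>Basis. \<Sum>b\<in>Basis. \<Sum>d\<in>Basis. \<eta> ((!) [a, b, c, d]) * r c a b d)"
      by (rule sum.swap)
    also have "\<dots> = (\<Sum>a\<in>Basis. \<Sum>b\<in>Basis. \<Sum>c\<in>Basis. \<Sum>d\<in>Basis. \<eta> ((!) [a, b, c, d]) * r c a b d)"
      by (rule sum.cong[OF refl]) (rule sum.swap)
    finally show ?thesis .
  qed
  have "s + s + s = (\<Sum>a\<in>Basis. \<Sum>b\<in>Basis. \<Sum>c\<in>Basis. \<Sum>d\<in>Basis.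
      \<eta> ((!) [a, b, c, d]) * (r a b c d + r b c a d + r c a b d))"
    by (subst (2) s1, subst (2) s2) (simp add: s_def sum.distrib distrib_left)
  then show ?thesis by (simp add: t bianchi)
qed

section \<open>The spectral theorem on bivectors\<close>

text \<open>Families rather than sets, since eigenbases will be numbered in the order of their
  eigenvalues; a set is treated as the family \<open>\<lambda>b. b\<close>.\<close>

definition orthonormal_family :: "'i set \<Rightarrow> ('i \<Rightarrow> 'b::real_inner) \<Rightarrow> bool"
  where "orthonormal_family I u \<longleftrightarrow> (\<forall>i\<in>I. \<forall>j\<in>I. u i \<bullet> u j = (if i = j then 1 else 0))"

lemma orthonormal_familyD:
  "orthonormal_family I u \<Longrightarrow> i \<in> I \<Longrightarrow> j \<in> I \<Longrightarrow> u i \<bullet> u j = (if i = j then 1 else 0)"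
  by (simp add: orthonormal_family_def)

lemma orthonormal_family_subset: "orthonormal_family I u \<Longrightarrow> J \<subseteq> I \<Longrightarrow> orthonormal_family J u"
  unfolding orthonormal_family_def by blast

lemma orthonormal_family_inj_on: "orthonormal_family I u \<Longrightarrow> inj_on u I"
  by (rule inj_onI) (metis orthonormal_familyD zero_neq_one)

lemma orthonormal_family_independent:
  fixes u :: "'i \<Rightarrow> 'b::real_inner"
  assumes "orthonormal_family I u"
  shows "independent (u ` I)"
proof (rule pairwise_orthogonal_independent)
  show "pairwise orthogonal (u ` I)"
    using assms by (auto simp: pairwise_def orthogonal_def orthonormal_family_def)
  show "0 \<notin> u ` I"
  proof
    assume "0 \<in> u ` I"
    then obtain i where "i \<in> I" "u i = 0" by auto
    then show False using orthonormal_familyD[OF assms, of i i] by simp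
  qed
qed

lemma orthonormal_family_sum_inner:
  fixes u :: "'i \<Rightarrow> 'b::real_inner"
  assumes I: "finite I" and u: "orthonormal_family I u" and j: "j \<in> I"
  shows "(\<Sum>i\<in>I. c i *\<^sub>R u i) \<bullet> u j = c j"
proof -
  have "(\<Sum>i\<in>I. c i *\<^sub>R u i) \<bullet> u j = (\<Sum>i\<in>I. if i = j then c i else 0)"
    unfolding inner_sum_left by (rule sum.cong) (auto simp: orthonormal_familyD[OF u _ j])
  then show ?thesis using I j by simp
qed

lemma orthonormal_family_expand:
  fixes u :: "'i \<Rightarrow> 'b::real_inner"
  assumes I: "finite I" and u: "orthonormal_family I u" and x: "x \<in> span (u ` I)"
  shows "(\<Sum>i\<in>I. (x \<bullet> u i) *\<^sub>R u i) = x"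
proof -
  from x obtain c where "x = (\<Sum>v\<in>u ` I. c v *\<^sub>R v)"
    using I by (auto simp: span_finite)
  then have c: "x = (\<Sum>i\<in>I. c (u i) *\<^sub>R u i)"
    by (simp add: sum.reindex[OF orthonormal_family_inj_on[OF u]])
  then have "x \<bullet> u j = c (u j)" if "j \<in> I" for j
    using orthonormal_family_sum_inner[OF I u that] by simp
  then show ?thesis using c by simp
qed

lemma so_trace_orthonormal_family:
  fixes T :: "'a::euclidean_space so \<Rightarrow> 'a so"
  assumes "linear T" "finite I" and u: "orthonormal_family I u" "span (u ` I) = UNIV"
  shows "so_trace T = (\<Sum>i\<in>I. T (u i) \<bullet> u i)"
proof -
  have inj: "inj_on u I" by (rule orthonormal_family_inj_on[OF u(1)])
  have "so_trace T = (\<Sum>b\<in>u ` I. T b \<bullet> b)"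
    using assms by (intro so_trace_orthonormal) (auto simp: orthonormal_family_def)
  then show ?thesis by (simp add: sum.reindex[OF inj])
qed

lemma real_choose_two: "real (n choose 2) = real n * (real n - 1) / 2"
  by (induction n) (auto simp: numeral_2_eq_2 field_simps)

text \<open>The trace of the identity is computed twice: in the given basis it counts the elements,
  from the definition it is n (n - 1) / 2.\<close>

lemma card_orthonormal_family_so:
  fixes u :: "'i \<Rightarrow> 'a::euclidean_space so"
  assumes "finite I" "orthonormal_family I u" "span (u ` I) = UNIV"
  shows "card I = DIM('a) choose 2"
proof -
  have "real (card I) = so_trace (\<lambda>\<alpha>::'a so. \<alpha>)"
    using assms by (subst so_trace_orthonormal_family[of _ I u])
      (auto simp: linear_ident orthonormal_familyD)
  also have "\<dots> = (\<Sum>a\<in>Basis. \<Sum>b\<in>(Basis::'a set). 1 - (if a = b then 1 else 0)) / 2"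
    unfolding so_trace_def
    by (intro arg_cong[of _ _ "\<lambda>x. x / 2"] sum.cong refl) (auto simp: inner_wedge_wedge inner_Basis)
  also have "\<dots> = real DIM('a) * (real DIM('a) - 1) / 2"
    by (simp add: sum_subtractf algebra_simps)
  also have "\<dots> = real (DIM('a) choose 2)"
    by (rule real_choose_two[symmetric])
  finally show ?thesis by simp
qed

text \<open>By induction a Minkowski sum of segments. The vectors may be dependent, so the redundant
  family of wedges can be inserted.\<close>

lemma compact_bounded_combinations:
  fixes v :: "'i \<Rightarrow> 'b::real_normed_vector"
  assumes "finite I"
  shows "compact {\<Sum>i\<in>I. t i *\<^sub>R v i |t. \<forall>i\<in>I. \<bar>t i\<bar> \<le> (1::real)}"
  using assms
proof (induction I)
  case empty
  then show ?case by simp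
next
  case (insert j I)
  let ?K = "{\<Sum>i\<in>I. t i *\<^sub>R v i |t. \<forall>i\<in>I. \<bar>t i\<bar> \<le> (1::real)}"
  let ?L = "(\<lambda>s. s *\<^sub>R v j) ` {-1..1::real}"
  have "compact ?L"
    by (intro compact_continuous_image continuous_intros compact_Icc)
  then have "compact {x + y |x y. x \<in> ?L \<and> y \<in> ?K}"
    by (rule compact_sums) (rule insert.IH)
  also have "{x + y |x y. x \<in> ?L \<and> y \<in> ?K}
      = {\<Sum>i\<in>insert j I. t i *\<^sub>R v i |t. \<forall>i\<in>insert j I. \<bar>t i\<bar> \<le> (1::real)}" (is "?A = ?B")
  proof (intro equalityI subsetI)
    fix z assume "z \<in> ?A"
    then obtain s t where st: "z = s *\<^sub>R v j + (\<Sum>i\<in>I. t i *\<^sub>R v i)" "\<bar>s\<bar> \<le> 1" "\<forall>i\<in>I. \<bar>t i\<bar> \<le> 1"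
      by (auto simp: abs_le_iff)
    have "(\<Sum>i\<in>I. t i *\<^sub>R v i) = (\<Sum>i\<in>I. (t(j := s)) i *\<^sub>R v i)"
      by (rule sum.cong) (use insert.hyps in auto)
    then have "z = (\<Sum>i\<in>insert j I. (t(j := s)) i *\<^sub>R v i)" using st insert.hyps by simp
    then show "z \<in> ?B" using st(2,3) by (intro CollectI exI[of _ "t(j := s)"]) auto
  next
    fix z assume "z \<in> ?B"
    then obtain t where t: "z = (\<Sum>i\<in>insert j I. t i *\<^sub>R v i)" "\<forall>i\<in>insert j I. \<bar>t i\<bar> \<le> (1::real)"
      by blast
    have "t j *\<^sub>R v j \<in> ?L" using t(2) by (intro imageI) (auto simp: abs_le_iff)
    moreover have "z = t j *\<^sub>R v j + (\<Sum>i\<in>I. t i *\<^sub>R v i)" using t insert.hyps by simp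
    ultimately show "z \<in> ?A" using t(2) by blast
  qed
  finally show ?case .
qed

lemma norm_wedge_Basis_le: "a \<in> Basis \<Longrightarrow> b \<in> Basis \<Longrightarrow> norm (wedge a b) \<le> 1"
  by (auto simp: norm_eq_sqrt_inner inner_wedge_wedge inner_Basis)

text \<open>By Cauchy-Schwarz the coefficients of a unit bivector in the wedge expansion are bounded
  by 1, so the set is a closed part of a compact set of combinations.\<close>

lemma compact_unit_sphere_complement_so:
  fixes B :: "'a::euclidean_space so set"
  shows "compact {\<alpha>. norm \<alpha> = 1 \<and> (\<forall>b\<in>B. \<alpha> \<bullet> b = 0)}" (is "compact ?S")
proof -
  let ?K = "{\<Sum>i\<in>Basis \<times> Basis. t i *\<^sub>R wedge (fst i) (snd i :: 'a) |t. \<forall>i\<in>Basis \<times> Basis. \<bar>t i\<bar> \<le> (1::real)}"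
  have "?S \<subseteq> ?K"
  proof
    fix \<alpha> assume \<alpha>: "\<alpha> \<in> ?S"
    define t where "t i = (\<alpha> \<bullet> wedge (fst i) (snd i)) / 2" for i
    have "\<alpha> = (\<Sum>i\<in>Basis \<times> Basis. t i *\<^sub>R wedge (fst i) (snd i))"
      by (subst so_expand[of \<alpha>]) (simp add: t_def scaleR_sum_right sum.cartesian_product case_prod_beta)
    moreover have "\<bar>t i\<bar> \<le> 1" if "i \<in> Basis \<times> Basis" for i
    proof -
      have "\<bar>\<alpha> \<bullet> wedge (fst i) (snd i)\<bar> \<le> norm \<alpha> * norm (wedge (fst i) (snd i))"
        by (rule Cauchy_Schwarz_ineq2)
      also have "\<dots> \<le> 1" using \<alpha> norm_wedge_Basis_le that by auto
      finally show ?thesis by (simp add: t_def)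
    qed
    ultimately show "\<alpha> \<in> ?K" by blast
  qed
  moreover have "closed ?S"
  proof -
    have "?S = {\<alpha>. norm \<alpha> = 1} \<inter> (\<Inter>b\<in>B. {\<alpha>. \<alpha> \<bullet> b = 0})" by auto
    also have "closed \<dots>"
      by (intro closed_Int closed_INT ballI closed_Collect_eq continuous_intros)
    finally show ?thesis .
  qed
  ultimately show ?thesis
    using compact_Int_closed[OF compact_bounded_combinations[of "Basis \<times> Basis"
        "\<lambda>i. wedge (fst i) (snd i)"], of ?S]
    by (simp add: Int_absorb1)
qed

lemma continuous_on_linear_so:
  fixes T :: "'a::euclidean_space so \<Rightarrow> 'b::real_normed_vector"
  assumes T: "linear T"
  shows "continuous_on S T"
proof -
  have "T = (\<lambda>\<alpha>. (1/2) *\<^sub>R (\<Sum>a\<in>Basis. \<Sum>b\<in>Basis. (\<alpha> \<bullet> wedge a b) *\<^sub>R T (wedge a b)))"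
    by (rule ext, subst so_expand) (simp only: linear_scale[OF T] linear_sum[OF T])
  then show ?thesis by (rule ssubst) (intro continuous_intros)
qed

text \<open>Maximise the Rayleigh quotient on the orthogonal complement of \<open>B\<close>.\<close>

lemma sym2_eigenvector_in_complement:
  fixes T :: "'a::euclidean_space so \<Rightarrow> 'a so"
  assumes T: "T \<in> sym2" and B: "finite B" "orthonormal_family B (\<lambda>b. b)" "span B \<noteq> UNIV"
    and l: "\<And>b. b \<in> B \<Longrightarrow> T b = l b *\<^sub>R b"
  obtains u \<mu> where "u \<bullet> u = 1" "\<And>b. b \<in> B \<Longrightarrow> u \<bullet> b = 0" "T u = \<mu> *\<^sub>R u"
proof -
  note lT = sym2_linear[OF T]
  let ?S = "{\<alpha>. norm \<alpha> = 1 \<and> (\<forall>b\<in>B. \<alpha> \<bullet> b = 0)}"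
  obtain x where x: "x \<notin> span B" using B(3) by blast
  \<comment> \<open>The residual of the orthogonal projection shows that the unit sphere of the
    complement is nonempty.\<close>
  define y where "y = x - (\<Sum>b\<in>B. (x \<bullet> b) *\<^sub>R b)"
  have "(\<Sum>b\<in>B. (x \<bullet> b) *\<^sub>R b) \<in> span B" by (intro span_sum span_scale span_base)
  then have y0: "y \<noteq> 0" using x by (auto simp: y_def)
  have yb: "y \<bullet> b = 0" if "b \<in> B" for b
    using orthonormal_family_sum_inner[OF B(1,2) that, of "\<lambda>b. x \<bullet> b"]
    by (simp add: y_def inner_diff_left)
  have "y /\<^sub>R norm y \<in> ?S" using y0 yb by simp
  then have ne: "?S \<noteq> {}" by blast
  have "continuous_on ?S (\<lambda>\<alpha>. T \<alpha> \<bullet> \<alpha>)"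
    by (intro continuous_intros continuous_on_linear_so lT)
  from continuous_attains_sup[OF compact_unit_sphere_complement_so ne this]
  obtain u where u: "norm u = 1" "\<And>b. b \<in> B \<Longrightarrow> u \<bullet> b = 0"
    and max: "\<And>v. v \<in> ?S \<Longrightarrow> T v \<bullet> v \<le> T u \<bullet> u" by auto
  have uu: "u \<bullet> u = 1" using u(1) by (simp add: norm_eq_1)
  define \<mu> where "\<mu> = T u \<bullet> u"
  have max': "T v \<bullet> v \<le> \<mu> * (v \<bullet> v)" if v: "\<And>b. b \<in> B \<Longrightarrow> v \<bullet> b = 0" for v
  proof (cases "v = 0")
    case True
    then show ?thesis by simp
  next
    case False
    have "T (v /\<^sub>R norm v) \<bullet> (v /\<^sub>R norm v) \<le> \<mu>"
      unfolding \<mu>_def by (rule max) (use False v in simp)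
    then have "(T v \<bullet> v) / (norm v)\<^sup>2 \<le> \<mu>"
      by (simp add: linear_scale[OF lT] power2_eq_square field_simps)
    then show ?thesis using False by (simp add: field_simps power2_norm_eq_inner)
  qed
  \<comment> \<open>First variation at the maximum: perturbing u by t w gives a linear term in t
    dominated by a quadratic one, for every real t.\<close>
  have ort: "T u \<bullet> w = 0" if w: "\<And>b. b \<in> B \<Longrightarrow> w \<bullet> b = 0" and uw: "u \<bullet> w = 0" for w
  proof -
    define c where "c = T u \<bullet> w"
    define d where "d = \<mu> * (w \<bullet> w) - T w \<bullet> w"
    have le: "2 * t * c \<le> t\<^sup>2 * d" for t :: real
    proof -
      have "T (u + t *\<^sub>R w) \<bullet> (u + t *\<^sub>R w) \<le> \<mu> * ((u + t *\<^sub>R w) \<bullet> (u + t *\<^sub>R w))"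
        by (rule max') (simp add: inner_add_left u w)
      moreover have "T w \<bullet> u = c"
        using sym2_inner[OF T, of w u] by (simp add: c_def inner_commute)
      ultimately show ?thesis
        using uw by (simp add: linear_add[OF lT] linear_scale[OF lT] inner_add_left inner_add_right
            uu inner_commute[of w u] c_def[symmetric] d_def \<mu>_def[symmetric] power2_eq_square algebra_simps)
    qed
    have "c = 0"
    proof (rule ccontr)
      assume c: "c \<noteq> 0"
      define e where "e = \<bar>d\<bar> + 1"
      have e: "e > 0" "d \<le> e" "d < 2 * e" by (auto simp: e_def)
      \<comment> \<open>At t = c / e the inequality says 2 e \<le> d after cancelling the square of
        c, while e was chosen with d < 2 e.\<close>
      have "2 * (c / e) * c \<le> (c / e)\<^sup>2 * d" by (rule le)
      then have "c\<^sup>2 * (2 * e) \<le> c\<^sup>2 * d"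
        using e by (simp add: field_simps power2_eq_square)
      then show False using c e by simp
    qed
    then show ?thesis by (simp add: c_def)
  qed
  \<comment> \<open>This vector is orthogonal to B and to u, hence an admissible direction w, and so
    it is orthogonal to itself.\<close>
  define z where "z = T u - \<mu> *\<^sub>R u"
  have "z \<bullet> b = 0" if "b \<in> B" for b
    using sym2_inner[OF T, of u b] u(2)[OF that] by (simp add: z_def inner_diff_left l[OF that])
  moreover have "u \<bullet> z = 0"
    by (simp add: z_def inner_diff_right uu \<mu>_def inner_commute)
  ultimately have "T u \<bullet> z = 0" "u \<bullet> z = 0" using ort by blast+
  then have "z \<bullet> z = 0" by (simp add: z_def inner_diff_left)
  then have "T u = \<mu> *\<^sub>R u" by (simp add: z_def)
  then show thesis using that uu u(2) by blast
qed

text \<open>An orthonormal set of eigenvectors of greatest cardinality must span, since otherwise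
  the preceding lemma enlarges it. Cardinalities are bounded because the wedges of basis vectors
  span.\<close>

lemma sym2_spectral:
  fixes T :: "'a::euclidean_space so \<Rightarrow> 'a so"
  assumes T: "T \<in> sym2"
  obtains B l where "finite B" "orthonormal_family B (\<lambda>b. b)" "span B = UNIV"
    "\<And>b. b \<in> B \<Longrightarrow> T b = l b *\<^sub>R b"
proof -
  define P where "P B \<longleftrightarrow> finite B \<and> orthonormal_family B (\<lambda>b. b) \<and> (\<forall>b\<in>B. \<exists>\<mu>. T b = \<mu> *\<^sub>R b)" for B
  let ?W = "(\<lambda>(a, b). wedge a b) ` (Basis \<times> Basis) :: 'a so set"
  have spW: "\<alpha> \<in> span ?W" for \<alpha>
    by (subst so_expand[of \<alpha>]) (intro span_scale span_sum span_base, auto)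
  have bd: "card B \<le> card ?W" if "P B" for B
  proof -
    have "independent B" using orthonormal_family_independent[of B "\<lambda>b. b"] that by (simp add: P_def)
    from independent_span_bound[OF _ this, of ?W] show ?thesis using spW by auto
  qed
  have "P {}" by (simp add: P_def orthonormal_family_def)
  then have "\<exists>B. P B \<and> (\<forall>C. P C \<longrightarrow> card C \<le> card B)"
    using bd by (intro ex_has_greatest_nat[of P "{}" card "Suc (card ?W)"]) (auto simp: less_Suc_eq_le)
  then obtain B where B: "P B" and max: "\<And>C. P C \<Longrightarrow> card C \<le> card B" by blast
  then have "\<forall>b\<in>B. \<exists>\<mu>. T b = \<mu> *\<^sub>R b" by (simp add: P_def)
  then obtain l where l: "\<And>b. b \<in> B \<Longrightarrow> T b = l b *\<^sub>R b" by metis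
  have B': "finite B" "orthonormal_family B (\<lambda>b. b)" using B by (auto simp: P_def)
  have "span B = UNIV"
  proof (rule ccontr)
    assume "span B \<noteq> UNIV"
    from sym2_eigenvector_in_complement[OF T B' this, of l] l
    obtain u \<mu> where u: "u \<bullet> u = 1" "\<And>b. b \<in> B \<Longrightarrow> u \<bullet> b = 0" "T u = \<mu> *\<^sub>R u" by blast
    have "u \<notin> B" using u(1) u(2)[of u] by auto
    moreover have "b \<bullet> u = 0" if "b \<in> B" for b using u(2)[OF that] by (simp add: inner_commute)
    then have "P (insert u B)"
      using B u by (auto simp: P_def orthonormal_family_def)
    ultimately show False using max[of "insert u B"] B' by simp
  qed
  then show thesis using that B' l by blast
qed

section \<open>The eigenvalue list read off from an eigenbasis\<close>

lemma sorted_concat_replicate: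
  "sorted (xs :: 'b::linorder list) \<Longrightarrow> sorted (concat (map (\<lambda>x. replicate (f x) x) xs))"
  by (induction xs) (auto simp: sorted_append)

text \<open>The eigenspace of \<mu> is spanned by the basis vectors with eigenvalue \<mu>, so its
  dimension, the multiplicity in the list, counts those vectors.\<close>

lemma eigenvalue_list_eigenbasis:
  fixes T :: "'a::euclidean_space so \<Rightarrow> 'a so"
  assumes T: "linear T" and I: "finite I" and u: "orthonormal_family I u" "span (u ` I) = UNIV"
    and l: "\<And>i. i \<in> I \<Longrightarrow> T (u i) = l i *\<^sub>R u i"
  shows "sorted (eigenvalue_list T)" and "mset (eigenvalue_list T) = image_mset l (mset_set I)"
proof -
  have ex: "(\<Sum>i\<in>I. (x \<bullet> u i) *\<^sub>R u i) = x" for x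
    using orthonormal_family_expand[OF I u(1)] u(2) by simp
  have eig: "{\<alpha>. T \<alpha> = \<mu> *\<^sub>R \<alpha>} = span (u ` {i \<in> I. l i = \<mu>})" (is "?E = span ?U") for \<mu>
  proof (intro equalityI subsetI)
    fix \<alpha> assume "\<alpha> \<in> ?E"
    then have \<alpha>: "T \<alpha> = \<mu> *\<^sub>R \<alpha>" by simp
    have "(\<alpha> \<bullet> u i) *\<^sub>R u i \<in> span ?U" if i: "i \<in> I" for i
    proof (cases "l i = \<mu>")
      case True
      then show ?thesis using i by (intro span_scale span_base) auto
    next
      case False
      \<comment> \<open>Comparing coefficients at u i yields (\<alpha> \<bullet> u i) l i = \<mu>
        (\<alpha> \<bullet> u i).\<close>
      have "T \<alpha> = (\<Sum>i\<in>I. ((\<alpha> \<bullet> u i) * l i) *\<^sub>R u i)"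
        by (subst ex[of \<alpha>, symmetric]) (simp add: linear_sum[OF T] linear_scale[OF T] l)
      then have "T \<alpha> \<bullet> u i = (\<alpha> \<bullet> u i) * l i"
        using orthonormal_family_sum_inner[OF I u(1) i] by simp
      then have "\<alpha> \<bullet> u i = 0" using \<alpha> False by simp
      then show ?thesis by (simp add: span_zero)
    qed
    then have "(\<Sum>i\<in>I. (\<alpha> \<bullet> u i) *\<^sub>R u i) \<in> span ?U" by (rule span_sum)
    then show "\<alpha> \<in> span ?U" by (simp add: ex)
  next
    have "span ?U \<subseteq> ?E"
    proof (rule span_minimal)
      show "subspace ?E"
        by (auto simp: subspace_def linear_0[OF T] linear_add[OF T] linear_scale[OF T] scaleR_add_right)
    qed (auto simp: l)
    then show "\<alpha> \<in> ?E" if "\<alpha> \<in> span ?U" for \<alpha> using that by blast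
  qed
  have dim: "dim {\<alpha>. T \<alpha> = \<mu> *\<^sub>R \<alpha>} = card {i \<in> I. l i = \<mu>}" for \<mu>
  proof -
    have on: "orthonormal_family {i \<in> I. l i = \<mu>} u"
      by (rule orthonormal_family_subset[OF u(1)]) auto
    show ?thesis
      unfolding eig dim_span_eq_card_independent[OF orthonormal_family_independent[OF on]]
      by (rule card_image[OF orthonormal_family_inj_on[OF on]])
  qed
  have ev: "{\<mu>. \<exists>\<alpha>. \<alpha> \<noteq> 0 \<and> T \<alpha> = \<mu> *\<^sub>R \<alpha>} = l ` I"
  proof (intro equalityI subsetI)
    fix \<mu> assume "\<mu> \<in> {\<mu>. \<exists>\<alpha>. \<alpha> \<noteq> 0 \<and> T \<alpha> = \<mu> *\<^sub>R \<alpha>}"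
    then obtain \<alpha> where \<alpha>: "\<alpha> \<noteq> 0" "\<alpha> \<in> span (u ` {i \<in> I. l i = \<mu>})" unfolding eig[symmetric] by auto
    show "\<mu> \<in> l ` I"
    proof (rule ccontr)
      assume "\<mu> \<notin> l ` I"
      then have "{i \<in> I. l i = \<mu>} = {}" by auto
      then have "span (u ` {i \<in> I. l i = \<mu>}) = {0}" by (simp only: image_empty span_empty)
      then show False using \<alpha> by blast
    qed
  next
    fix \<mu> assume "\<mu> \<in> l ` I"
    then obtain i where i: "i \<in> I" "\<mu> = l i" by auto
    then have "u i \<noteq> 0" using orthonormal_familyD[OF u(1), of i i] by auto
    then show "\<mu> \<in> {\<mu>. \<exists>\<alpha>. \<alpha> \<noteq> 0 \<and> T \<alpha> = \<mu> *\<^sub>R \<alpha>}" using l i by auto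
  qed
  show "sorted (eigenvalue_list T)"
    unfolding eigenvalue_list_def by (rule sorted_concat_replicate) simp
  have cnt: "count (mset (concat (map (\<lambda>x. replicate (f x) x) xs))) \<nu> = (if \<nu> \<in> set xs then f \<nu> else 0)"
    if "distinct xs" for f and xs :: "real list" and \<nu>
    using that by (induction xs) auto
  show "mset (eigenvalue_list T) = image_mset l (mset_set I)"
  proof (rule multiset_eqI)
    fix \<nu>
    have "count (mset (eigenvalue_list T)) \<nu> = (if \<nu> \<in> l ` I then card {i \<in> I. l i = \<nu>} else 0)"
      unfolding eigenvalue_list_def ev dim using I by (subst cnt) auto
    also have "\<dots> = card {i \<in> I. \<nu> = l i}"
      by (auto intro!: arg_cong[of _ _ card] simp: card_eq_0_iff)
    also have "\<dots> = count (image_mset l (mset_set I)) \<nu>"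
      using I by (simp add: count_image_mset')
    finally show "count (mset (eigenvalue_list T)) \<nu> = count (image_mset l (mset_set I)) \<nu>" .
  qed
qed

lemma eigenvalue_list_eqI:
  fixes T :: "'a::euclidean_space so \<Rightarrow> 'a so"
  assumes "linear T" "orthonormal_family {..<N} u" "span (u ` {..<N}) = UNIV"
    and "\<And>i. i < N \<Longrightarrow> T (u i) = l i *\<^sub>R u i" and mono: "\<And>i j. i \<le> j \<Longrightarrow> j < N \<Longrightarrow> l i \<le> l j"
  shows "eigenvalue_list T = map l [0..<N]"
proof -
  have "mset (eigenvalue_list T) = mset (map l [0..<N])"
    using eigenvalue_list_eigenbasis(2)[of T "{..<N}" u l] assms by (simp add: atLeast0LessThan)
  moreover have "sorted (map l [0..<N])"
    unfolding sorted_iff_nth_mono using mono by auto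
  moreover have "sorted (eigenvalue_list T)"
    using eigenvalue_list_eigenbasis(1)[of T "{..<N}" u l] assms by simp
  ultimately show ?thesis
    by (metis properties_for_sort sorted_sort_id)
qed

lemma sym2_eigenbasis:
  fixes T :: "'a::euclidean_space so \<Rightarrow> 'a so"
  assumes T: "T \<in> sym2"
  obtains u l where "orthonormal_family {..<DIM('a) choose 2} u" "span (u ` {..<DIM('a) choose 2}) = UNIV"
    "\<And>i. i < DIM('a) choose 2 \<Longrightarrow> T (u i) = l i *\<^sub>R u i"
    "\<And>i j. i \<le> j \<Longrightarrow> j < DIM('a) choose 2 \<Longrightarrow> l i \<le> l j"
    "eigenvalue_list T = map l [0..<DIM('a) choose 2]"
proof -
  let ?N = "DIM('a) choose 2"
  from sym2_spectral[OF T] obtain B l where B: "finite B" "orthonormal_family B (\<lambda>b. b)" "span B = UNIV"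
    and l: "\<And>b. b \<in> B \<Longrightarrow> T b = l b *\<^sub>R b" by metis
  obtain bs0 where bs0: "set bs0 = B" "distinct bs0" using finite_distinct_list[OF B(1)] by blast
  define bs where "bs = sort_key l bs0"
  have bs: "set bs = B" "distinct bs" "sorted (map l bs)" using bs0 by (auto simp: bs_def)
  have len: "length bs = ?N"
    using card_orthonormal_family_so[of B "\<lambda>b. b"] B distinct_card[OF bs(2)] bs(1) by simp
  define u where "u i = bs ! i" for i
  have img: "u ` {..<?N} = B"
    using bs(1) len by (auto simp: u_def set_conv_nth)
  have uB: "u i \<in> B" if "i < ?N" for i using img that by auto
  have on: "orthonormal_family {..<?N} u"
    using B(2) bs(2) len uB
    by (auto simp: orthonormal_family_def u_def nth_eq_iff_index_eq)
  have mono: "l (u i) \<le> l (u j)" if "i \<le> j" "j < ?N" for i j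
    using sorted_nth_mono[OF bs(3) that(1)] that len by (simp add: u_def)
  have lu: "T (u i) = l (u i) *\<^sub>R u i" if "i < ?N" for i using l uB that by blast
  have sp: "span (u ` {..<?N}) = UNIV" using img B(3) by simp
  have ev: "eigenvalue_list T = map (\<lambda>i. l (u i)) [0..<?N]"
    by (rule eigenvalue_list_eqI[OF sym2_linear[OF T] on sp]) (erule lu, erule (1) mono)
  show thesis
    by (rule that[of u "\<lambda>i. l (u i)", OF on sp _ _ ev]) (erule lu, erule (1) mono)
qed

section \<open>Sums of lowest eigenvalues\<close>

text \<open>The weights are 1 below the integer part of k, the fractional part at it and 0 beyond.
  This single formula replaces the case distinction on whether k is an integer.\<close>

lemma lowest_eigenvalue_sum_weights:
  fixes T :: "'a::euclidean_space so \<Rightarrow> 'a so"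
  assumes k: "0 \<le> k" "k \<le> real N" and T: "eigenvalue_list T = map l [0..<N]"
  shows "lowest_eigenvalue_sum k T = (\<Sum>i<N. max 0 (min 1 (k - real i)) * l i)"
proof -
  define m where "m = nat \<lfloor>k\<rfloor>"
  have m: "real m \<le> k" "k < real m + 1" using k unfolding m_def by linarith+
  have mN: "m \<le> N" using m k by linarith
  have km: "(k \<in> \<int>) = (k = real m)"
  proof
    assume "k \<in> \<int>"
    then obtain z where "k = of_int z" by (auto elim: Ints_cases)
    then show "k = real m" using k by (simp add: m_def)
  qed (metis Ints_of_nat)
  have w: "max 0 (min 1 (k - real i)) * l i =
      (if i < m then l i else 0) + (if i = m then (k - real m) * l i else 0)" for i
  proof (cases i m rule: linorder_cases)
    case less
    then have "real i + 1 \<le> real m" by linarith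
    then show ?thesis using m less by simp
  next
    case equal
    then show ?thesis using m by simp
  next
    case greater
    then have "real m + 1 \<le> real i" by linarith
    then show ?thesis using m greater by simp
  qed
  have "(\<Sum>i<N. max 0 (min 1 (k - real i)) * l i)
      = (\<Sum>i<N. if i < m then l i else 0) + (\<Sum>i<N. if i = m then (k - real m) * l i else 0)"
    unfolding w by (rule sum.distrib)
  also have "(\<Sum>i<N. if i < m then l i else 0) = (\<Sum>i<m. l i)"
    using mN by (intro sum.mono_neutral_cong_right) auto
  \<comment> \<open>For k = N the index m = N lies outside the list; the fractional weight is then
    0.\<close>
  also have "(\<Sum>i<N. if i = m then (k - real m) * l i else 0) = (if m < N then (k - real m) * l m else 0)"
    by simp
  finally have s: "(\<Sum>i<N. max 0 (min 1 (k - real i)) * l i)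
      = (\<Sum>i<m. l i) + (if m < N then (k - real m) * l m else 0)" .
  have r: "real_of_int \<lfloor>k\<rfloor> = real m" using k by (simp add: m_def)
  have e: "eigenvalue_list T ! i = l i" if "i < N" for i using that by (simp add: T)
  have "(\<Sum>i<m. eigenvalue_list T ! i) = (\<Sum>i<m. l i)" using mN by (intro sum.cong refl e) auto
  moreover have "m < N" if "k \<noteq> real m" using that m k mN by (cases "m = N") auto
  ultimately show ?thesis
    unfolding lowest_eigenvalue_sum_def s r km m_def[symmetric] using e by auto
qed

lemma sum_lowest_weights:
  assumes "0 \<le> k" "k \<le> real N"
  shows "(\<Sum>i<N. max 0 (min 1 (k - real i))) = k"
proof -
  have "(\<Sum>i<N. max 0 (min 1 (k - real i))) = min k (real N)" for N
    using assms(1) by (induction N) auto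
  then show ?thesis using assms by simp
qed

text \<open>
  Compare \<open>s\<close> with the weights \<open>c\<close> times \<open>max 0 (min 1 (k - i))\<close>: the difference is
  nonpositive before the pivot index \<open>m\<close> and nonnegative after it.
\<close>

lemma lowest_weights_minimal:
  fixes l s :: "nat \<Rightarrow> real"
  assumes k: "0 \<le> k" "k \<le> real N"
    and mono: "\<And>i j. i \<le> j \<Longrightarrow> j < N \<Longrightarrow> l i \<le> l j"
    and s: "\<And>i. i < N \<Longrightarrow> 0 \<le> s i" "\<And>i. i < N \<Longrightarrow> s i \<le> c" "(\<Sum>i<N. s i) = c * k"
  shows "c * (\<Sum>i<N. max 0 (min 1 (k - real i)) * l i) \<le> (\<Sum>i<N. l i * s i)"
proof (cases "N = 0")
  case False
  let ?w = "\<lambda>i. max 0 (min 1 (k - real i))"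
  \<comment> \<open>The cap at N - 1 keeps the pivot a valid index when k = N.\<close>
  define m where "m = min (nat \<lfloor>k\<rfloor>) (N - 1)"
  have "0 \<le> (l i - l m) * (s i - c * ?w i)" if i: "i < N" for i
  proof (cases i m rule: linorder_cases)
    case less
    then have "?w i = 1" using k unfolding m_def by linarith
    moreover have "l i \<le> l m" using less mono[of i m] False by (simp add: m_def)
    ultimately show ?thesis using s(2)[OF i] by (simp add: mult_nonpos_nonpos)
  next
    case equal
    then show ?thesis by simp
  next
    case greater
    then have "?w i = 0" using k i unfolding m_def by linarith
    moreover have "l m \<le> l i" using greater mono[of m i] i by simp
    ultimately show ?thesis using s(1)[OF i] by simp
  qed
  then have "0 \<le> (\<Sum>i<N. (l i - l m) * (s i - c * ?w i))" by (intro sum_nonneg) auto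
  \<comment> \<open>Subtracting the pivot value l m costs nothing, because both weightings have
    total c k.\<close>
  also have "\<dots> = (\<Sum>i<N. l i * s i) - c * (\<Sum>i<N. ?w i * l i) - l m * ((\<Sum>i<N. s i) - c * (\<Sum>i<N. ?w i))"
    by (simp add: algebra_simps sum_subtractf sum.distrib sum_distrib_left)
  also have "\<dots> = (\<Sum>i<N. l i * s i) - c * (\<Sum>i<N. ?w i * l i)"
    by (simp add: sum_lowest_weights[OF k] s(3))
  finally show ?thesis by simp
qed simp

section \<open>The trace pairing and its minimum over operators of given trace and bound\<close>

lemma so_trace_add: "so_trace (\<lambda>\<alpha>. S \<alpha> + T \<alpha>) = so_trace S + so_trace T"
  by (simp add: so_trace_def inner_add_left sum.distrib add_divide_distrib)

lemma so_trace_scaleR: "so_trace (\<lambda>\<alpha>. c *\<^sub>R T \<alpha>) = c * so_trace T"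
  by (simp add: so_trace_def sum_distrib_left)

lemma so_trace_sum: "so_trace (\<lambda>\<alpha>. \<Sum>i\<in>I. T i \<alpha>) = (\<Sum>i\<in>I. so_trace (T i))"
proof (induction I rule: infinite_finite_induct)
  case (insert i I)
  then show ?case by (simp add: so_trace_add)
qed (simp_all add: so_trace_def)

lemma so_trace_rank_one: "so_trace (\<lambda>\<alpha>. (\<alpha> \<bullet> v) *\<^sub>R w) = v \<bullet> w"
  by (simp add: so_trace_def so_parseval[of v w] inner_commute)

text \<open>Both sides are the sum of m \<bullet> \<R> m over the moments m of \<omega>, divided by
  p!.\<close>

lemma form_inner_Ric_L_trace:
  fixes \<omega> :: "(nat \<Rightarrow> 'a::euclidean_space) \<Rightarrow> real"
  assumes \<omega>: "\<omega> \<in> forms p" and R: "\<R> \<in> sym2"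
  shows "form_inner p (Ric_L p \<R> \<omega>) \<omega> = so_trace (\<lambda>\<alpha>. \<R> (action_op p \<omega> \<alpha>))"
proof -
  let ?P = "{..<p} \<rightarrow>\<^sub>E (Basis :: 'a set)"
  let ?m = "form_moment p \<omega>"
  have "so_trace (\<lambda>\<alpha>. \<R> (action_op p \<omega> \<alpha>))
      = (\<Sum>a\<in>Basis. \<Sum>b\<in>Basis. \<Sum>Y\<in>?P. (?m Y \<bullet> wedge a b) * (\<R> (?m Y) \<bullet> wedge a b)) / 2 / fact p"
    by (simp add: so_trace_def sym2_inner[OF R] inner_action_op_moment[OF \<omega>] sum_divide_distrib
        mult.commute[of 2])
  also have "(\<Sum>a\<in>Basis. \<Sum>b\<in>Basis. \<Sum>Y\<in>?P. (?m Y \<bullet> wedge a b) * (\<R> (?m Y) \<bullet> wedge a b))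
      = (\<Sum>Y\<in>?P. \<Sum>a\<in>Basis. \<Sum>b\<in>Basis. (?m Y \<bullet> wedge a b) * (\<R> (?m Y) \<bullet> wedge a b))"
    by (simp add: sum.swap[of _ Basis ?P])
  also have "\<dots> / 2 = (\<Sum>Y\<in>?P. ?m Y \<bullet> \<R> (?m Y))"
    unfolding so_parseval[of "?m Y" "\<R> (?m Y)" for Y] sum_divide_distrib ..
  finally show ?thesis by (simp add: form_inner_Ric_L[OF \<omega> R] inner_commute)
qed

text \<open>The defining description fixes each value of the operator separately, so symmetry comes
  first; linearity follows by moving the operator to the other argument.\<close>

lemma action_op_in_sym2:
  assumes "\<omega> \<in> forms p"
  shows "action_op p \<omega> \<in> sym2"
proof -
  have s: "action_op p \<omega> \<alpha> \<bullet> \<beta> = \<alpha> \<bullet> action_op p \<omega> \<beta>" for \<alpha> \<beta>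
    by (subst inner_commute[of \<alpha>]) (simp add: inner_action_op_moment[OF assms] mult.commute)
  have "action_op p \<omega> (\<alpha> + \<beta>) = action_op p \<omega> \<alpha> + action_op p \<omega> \<beta>" for \<alpha> \<beta>
    by (subst vector_eq_rdot[symmetric]) (simp add: s inner_add_left)
  moreover have "action_op p \<omega> (c *\<^sub>R \<alpha>) = c *\<^sub>R action_op p \<omega> \<alpha>" for c \<alpha>
    by (subst vector_eq_rdot[symmetric]) (simp add: s)
  ultimately show ?thesis using s by (auto simp: sym2_def intro!: linearI)
qed

lemma sym2_add: "S \<in> sym2 \<Longrightarrow> T \<in> sym2 \<Longrightarrow> (\<lambda>\<alpha>. S \<alpha> + T \<alpha>) \<in> sym2"
  by (auto simp: sym2_def linear_compose_add inner_add_left inner_add_right)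

lemma sym2_scaleR: "T \<in> sym2 \<Longrightarrow> (\<lambda>\<alpha>. c *\<^sub>R T \<alpha>) \<in> sym2"
  by (auto simp: sym2_def linear_compose_scale_right)

text \<open>The set K of the overview. For c = 1 and a natural number t it is the convex hull of the
  orthogonal projections of rank t.\<close>

definition bounded_trace_ops :: "real \<Rightarrow> real \<Rightarrow> ('a::euclidean_space so \<Rightarrow> 'a so) set"
  where "bounded_trace_ops c t =
    {S \<in> sym2. (\<forall>\<alpha>. 0 \<le> S \<alpha> \<bullet> \<alpha>) \<and> (\<forall>\<alpha>. S \<alpha> \<bullet> \<alpha> \<le> c * (\<alpha> \<bullet> \<alpha>)) \<and> so_trace S = t}"

text \<open>The minimizer is diagonal in an eigenbasis of \<R>, with entries c times the
  lowest-eigenvalue weights. Its existence also shows that the set is nonempty.\<close>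

lemma bounded_trace_ops_minimizer:
  fixes \<R> :: "'a::euclidean_space so \<Rightarrow> 'a so"
  assumes R: "\<R> \<in> sym2" and c: "0 \<le> c" and k: "0 \<le> k" "k \<le> real (DIM('a) choose 2)"
  obtains S where "S \<in> bounded_trace_ops c (c * k)"
    "so_trace (\<lambda>\<alpha>. \<R> (S \<alpha>)) = c * lowest_eigenvalue_sum k \<R>"
proof -
  let ?N = "DIM('a) choose 2"
  let ?w = "\<lambda>i. max 0 (min 1 (k - real i))"
  from sym2_eigenbasis[OF R] obtain u l
    where on: "orthonormal_family {..<?N} u" and sp: "span (u ` {..<?N}) = UNIV"
    and l: "\<And>i. i < ?N \<Longrightarrow> \<R> (u i) = l i *\<^sub>R u i" and ev: "eigenvalue_list \<R> = map l [0..<?N]"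
    by metis
  note lR = sym2_linear[OF R]
  have uu: "u i \<bullet> u i = 1" if "i < ?N" for i using orthonormal_familyD[OF on, of i i] that by simp
  define S where "S \<alpha> = (\<Sum>i<?N. (c * ?w i) *\<^sub>R ((\<alpha> \<bullet> u i) *\<^sub>R u i))" for \<alpha>
  have "linear S"
    by (rule linearI)
      (simp_all add: S_def inner_add_left scaleR_add_left scaleR_add_right sum.distrib
        scaleR_sum_right mult_ac)
  moreover have "S \<alpha> \<bullet> \<beta> = \<alpha> \<bullet> S \<beta>" for \<alpha> \<beta>
    by (simp add: S_def inner_sum_left inner_sum_right inner_commute mult_ac)
  ultimately have "S \<in> sym2" by (simp add: sym2_def)
  moreover have SS: "S \<alpha> \<bullet> \<alpha> = (\<Sum>i<?N. c * ?w i * (\<alpha> \<bullet> u i)\<^sup>2)" for \<alpha>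
    unfolding S_def inner_sum_left
    by (intro sum.cong refl) (simp add: power2_eq_square inner_commute mult_ac)
  have "0 \<le> S \<alpha> \<bullet> \<alpha>" for \<alpha>
    unfolding SS using c by (intro sum_nonneg mult_nonneg_nonneg) auto
  moreover have "S \<alpha> \<bullet> \<alpha> \<le> c * (\<alpha> \<bullet> \<alpha>)" for \<alpha>
  proof -
    have "\<alpha> \<bullet> \<alpha> = (\<Sum>i<?N. (\<alpha> \<bullet> u i) *\<^sub>R u i) \<bullet> \<alpha>"
      using orthonormal_family_expand[OF _ on, of \<alpha>] sp by simp
    also have "\<dots> = (\<Sum>i<?N. (\<alpha> \<bullet> u i)\<^sup>2)"
      unfolding inner_sum_left by (intro sum.cong refl) (simp add: power2_eq_square inner_commute)
    finally have "c * (\<alpha> \<bullet> \<alpha>) = (\<Sum>i<?N. c * 1 * (\<alpha> \<bullet> u i)\<^sup>2)" by (simp add: sum_distrib_left)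
    then show ?thesis
      unfolding SS using c by (simp only:) (intro sum_mono mult_right_mono mult_left_mono; simp)
  qed
  moreover have "so_trace S = c * k"
  proof -
    have "so_trace S = (\<Sum>i<?N. c * ?w i)"
      unfolding S_def so_trace_sum so_trace_scaleR so_trace_rank_one
      by (intro sum.cong refl) (simp add: uu)
    then show ?thesis using sum_lowest_weights[OF k] by (simp flip: sum_distrib_left)
  qed
  moreover have "so_trace (\<lambda>\<alpha>. \<R> (S \<alpha>)) = c * lowest_eigenvalue_sum k \<R>"
  proof -
    have "so_trace (\<lambda>\<alpha>. \<R> (S \<alpha>)) = (\<Sum>i<?N. c * ?w i * l i)"
      unfolding S_def linear_sum[OF lR] linear_scale[OF lR] so_trace_sum so_trace_scaleR so_trace_rank_one
      by (intro sum.cong refl) (simp add: uu l)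
    then show ?thesis
      by (simp add: lowest_eigenvalue_sum_weights[OF k ev] sum_distrib_left mult.assoc)
  qed
  ultimately show thesis using that by (auto simp: bounded_trace_ops_def)
qed

text \<open>Ky Fan's principle: only the diagonal of S in an eigenbasis of \<R> enters the pairing.
  Its entries lie between 0 and c and add up to c k, so \<open>lowest_weights_minimal\<close>
  applies.\<close>

lemma bounded_trace_ops_lower_bound:
  fixes \<R> :: "'a::euclidean_space so \<Rightarrow> 'a so"
  assumes R: "\<R> \<in> sym2" and S: "S \<in> bounded_trace_ops c (c * k)"
    and k: "0 \<le> k" "k \<le> real (DIM('a) choose 2)"
  shows "c * lowest_eigenvalue_sum k \<R> \<le> so_trace (\<lambda>\<alpha>. \<R> (S \<alpha>))"
proof -
  let ?N = "DIM('a) choose 2"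
  from sym2_eigenbasis[OF R] obtain u l
    where on: "orthonormal_family {..<?N} u" and sp: "span (u ` {..<?N}) = UNIV"
    and l: "\<And>i. i < ?N \<Longrightarrow> \<R> (u i) = l i *\<^sub>R u i"
    and mono: "\<And>i j. i \<le> j \<Longrightarrow> j < ?N \<Longrightarrow> l i \<le> l j"
    and ev: "eigenvalue_list \<R> = map l [0..<?N]"
    by metis
  have S': "S \<in> sym2" "so_trace S = c * k" "\<And>\<alpha>. 0 \<le> S \<alpha> \<bullet> \<alpha>" "\<And>\<alpha>. S \<alpha> \<bullet> \<alpha> \<le> c * (\<alpha> \<bullet> \<alpha>)"
    using S by (auto simp: bounded_trace_ops_def)
  note tr = so_trace_orthonormal_family[OF _ finite_lessThan on sp]
  have "so_trace (\<lambda>\<alpha>. \<R> (S \<alpha>)) = (\<Sum>i<?N. \<R> (S (u i)) \<bullet> u i)"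
    using linear_compose[OF sym2_linear[OF S'(1)] sym2_linear[OF R]]
    by (intro tr) (simp add: comp_def)
  also have "\<dots> = (\<Sum>i<?N. l i * (S (u i) \<bullet> u i))"
    by (intro sum.cong refl) (simp add: sym2_inner[OF R] l)
  finally have t: "so_trace (\<lambda>\<alpha>. \<R> (S \<alpha>)) = (\<Sum>i<?N. l i * (S (u i) \<bullet> u i))" .
  have "S (u i) \<bullet> u i \<le> c" if "i < ?N" for i
    using S'(4)[of "u i"] orthonormal_familyD[OF on, of i i] that by simp
  then show ?thesis
    unfolding t lowest_eigenvalue_sum_weights[OF k ev]
    using S'(3) mono S'(2) tr[OF sym2_linear[OF S'(1)]]
    by (intro lowest_weights_minimal k) auto
qed

text \<open>The eigenbasis is unchanged, every eigenvalue moves by d, and the weights have total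
  k.\<close>

lemma lowest_eigenvalue_sum_shift:
  fixes \<R> :: "'a::euclidean_space so \<Rightarrow> 'a so"
  assumes R: "\<R> \<in> sym2" and k: "0 \<le> k" "k \<le> real (DIM('a) choose 2)"
  shows "lowest_eigenvalue_sum k (\<lambda>\<alpha>. \<R> \<alpha> + d *\<^sub>R \<alpha>) = lowest_eigenvalue_sum k \<R> + k * d"
proof -
  let ?N = "DIM('a) choose 2"
  from sym2_eigenbasis[OF R] obtain u l
    where on: "orthonormal_family {..<?N} u" and sp: "span (u ` {..<?N}) = UNIV"
    and l: "\<And>i. i < ?N \<Longrightarrow> \<R> (u i) = l i *\<^sub>R u i"
    and mono: "\<And>i j. i \<le> j \<Longrightarrow> j < ?N \<Longrightarrow> l i \<le> l j"
    and ev: "eigenvalue_list \<R> = map l [0..<?N]"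
    by metis
  have "eigenvalue_list (\<lambda>\<alpha>. \<R> \<alpha> + d *\<^sub>R \<alpha>) = map (\<lambda>i. l i + d) [0..<?N]"
    by (rule eigenvalue_list_eqI[OF _ on sp])
      (auto intro!: linear_compose_add linear_compose_scale_right linear_ident sym2_linear[OF R]
        simp: l mono scaleR_add_left)
  from lowest_eigenvalue_sum_weights[OF k this] lowest_eigenvalue_sum_weights[OF k ev]
  show ?thesis
    using sum_lowest_weights[OF k] by (simp add: distrib_left sum.distrib flip: sum_distrib_right)
qed

lemma alg_curvature_shift:
  fixes \<R> :: "'a::euclidean_space so \<Rightarrow> 'a so"
  assumes "\<R> \<in> alg_curvature_operators"
  shows "(\<lambda>\<alpha>. \<R> \<alpha> + d *\<^sub>R \<alpha>) \<in> alg_curvature_operators"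
proof -
  have s: "\<R> \<in> sym2" "(\<lambda>\<alpha>::'a so. \<alpha>) \<in> sym2"
    using assms id_alg_curvature[where 'a='a] by (auto simp: alg_curvature_operators_def)
  have b: "so_apply (\<R> (wedge x y)) z + so_apply (\<R> (wedge y z)) x + so_apply (\<R> (wedge z x)) y = 0"
    and i: "so_apply (wedge x y) z + so_apply (wedge y z) x + so_apply (wedge z x) y = 0"
    for x y z :: 'a
    using assms id_alg_curvature[where 'a='a] by (auto simp: alg_curvature_operators_def)
  have "so_apply (\<R> (wedge x y) + d *\<^sub>R wedge x y) z + so_apply (\<R> (wedge y z) + d *\<^sub>R wedge y z) x
      + so_apply (\<R> (wedge z x) + d *\<^sub>R wedge z x) y
      = (so_apply (\<R> (wedge x y)) z + so_apply (\<R> (wedge y z)) x + so_apply (\<R> (wedge z x)) y)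
        + d *\<^sub>R (so_apply (wedge x y) z + so_apply (wedge y z) x + so_apply (wedge z x) y)" for x y z :: 'a
    by (simp add: plus_so.rep_eq scaleR_so.rep_eq scaleR_add_right)
  then show ?thesis
    unfolding alg_curvature_operators_def using sym2_add[OF s(1) sym2_scaleR[OF s(2)]] b i by simp
qed

section \<open>Separation by an algebraic curvature operator\<close>

text \<open>
  The operator \<open>hat \<eta>\<close> of \<open>\<eta> = x \<and> y \<and> z \<and> w\<close>, by Laplace expansion along two rows.  Its trace
  pairing with \<open>\<R>\<close> is twice the Bianchi sum of \<open>\<R>\<close> at \<open>(x, y, z, w)\<close>.
\<close>

definition wedge_product_op ::
  "'a::euclidean_space \<Rightarrow> 'a \<Rightarrow> 'a \<Rightarrow> 'a \<Rightarrow> 'a so \<Rightarrow> 'a so"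
  where "wedge_product_op x y z w \<alpha> =
    (\<alpha> \<bullet> wedge x y) *\<^sub>R wedge z w + (\<alpha> \<bullet> wedge z w) *\<^sub>R wedge x y
    + ((\<alpha> \<bullet> wedge y z) *\<^sub>R wedge x w + (\<alpha> \<bullet> wedge x w) *\<^sub>R wedge y z)
    + ((\<alpha> \<bullet> wedge z x) *\<^sub>R wedge y w + (\<alpha> \<bullet> wedge y w) *\<^sub>R wedge z x)"

lemma wedge_product_op_hat:
  fixes x y z w :: "'a::euclidean_space"
  obtains \<eta> where "\<eta> \<in> forms 4" "hat \<eta> = wedge_product_op x y z w"
proof -
  let ?T = "wedge_product_op x y z w"
  define N where "N a b c d = ?T (wedge a b) \<bullet> wedge c d" for a b c d
  define \<eta> where "\<eta> X = N (X 0) (X 1) (X 2) (X 3)" for X :: "nat \<Rightarrow> 'a"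
  \<comment> \<open>This is the determinant of the inner products of a, b, c, d with x, y, z, w,
    expanded along the rows of a and b. As an explicit polynomial, its vanishing for each of the six
    pairs of equal arguments becomes plain algebra.\<close>
  have Ndef: "N a b c d =
     ((a \<bullet> x) * (b \<bullet> y) - (b \<bullet> x) * (a \<bullet> y)) * ((z \<bullet> c) * (w \<bullet> d) - (w \<bullet> c) * (z \<bullet> d))
   + ((a \<bullet> z) * (b \<bullet> w) - (b \<bullet> z) * (a \<bullet> w)) * ((x \<bullet> c) * (y \<bullet> d) - (y \<bullet> c) * (x \<bullet> d))
   + ((a \<bullet> y) * (b \<bullet> z) - (b \<bullet> y) * (a \<bullet> z)) * ((x \<bullet> c) * (w \<bullet> d) - (w \<bullet> c) * (x \<bullet> d))
   + ((a \<bullet> x) * (b \<bullet> w) - (b \<bullet> x) * (a \<bullet> w)) * ((y \<bullet> c) * (z \<bullet> d) - (z \<bullet> c) * (y \<bullet> d))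
   + ((a \<bullet> z) * (b \<bullet> x) - (b \<bullet> z) * (a \<bullet> x)) * ((y \<bullet> c) * (w \<bullet> d) - (w \<bullet> c) * (y \<bullet> d))
   + ((a \<bullet> y) * (b \<bullet> w) - (b \<bullet> y) * (a \<bullet> w)) * ((z \<bullet> c) * (x \<bullet> d) - (x \<bullet> c) * (z \<bullet> d))"
    for a b c d
    by (simp add: N_def wedge_product_op_def inner_add_left inner_wedge_wedge)
  have alt: "N a a c d = 0" "N a b a d = 0" "N a b c a = 0" "N a b b d = 0" "N a b c b = 0" "N a b c c = 0"
    for a b c d
    unfolding Ndef by (simp_all add: inner_commute[of a] inner_commute[of b] inner_commute[of c] algebra_simps)
  have lin: "linear (\<lambda>v. N v b c d)" "linear (\<lambda>v. N a v c d)" "linear (\<lambda>v. N a b v d)" "linear (\<lambda>v. N a b c v)"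
    for a b c d
    by (rule linearI; simp add: Ndef inner_add_left inner_add_right algebra_simps)+
  have less4: "i < 4 \<Longrightarrow> i = 0 \<or> i = 1 \<or> i = 2 \<or> i = 3" for i :: nat by auto
  have "\<eta> \<in> forms 4"
    unfolding forms_def mem_Collect_eq
  proof (intro conjI allI impI)
    show "\<eta> X = \<eta> Y" if "\<forall>i<4. X i = Y i" for X Y
      using that by (simp add: \<eta>_def)
    show "linear (\<lambda>v. \<eta> (X(i := v)))" if "i < 4" for i X
      using less4[OF that] lin by (auto simp: \<eta>_def)
    show "\<eta> X = 0" if "i < 4" "j < 4" "i \<noteq> j" "X i = X j" for X i j
      using less4[OF that(1)] less4[OF that(2)] that(3,4) alt by (auto simp: \<eta>_def)
  qed
  moreover have "linear ?T"
    by (rule linearI) (simp_all add: wedge_product_op_def inner_add_left scaleR_add_left scaleR_add_right)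
  then have "hat \<eta> = ?T"
    using linear_hat[OF calculation] inner_hat_wedge[OF calculation]
    by (intro so_linear_eqI) (auto simp: \<eta>_def N_def numeral_3_eq_3 numeral_2_eq_2)
  ultimately show thesis using that by blast
qed

text \<open>Decomposable four-forms suffice as tests: their pairing with \<R> gives the component
  along w of the Bianchi sum, doubled by self-adjointness, and w is arbitrary.\<close>

lemma hat_orthogonal_imp_alg_curvature:
  fixes \<R> :: "'a::euclidean_space so \<Rightarrow> 'a so"
  assumes R: "\<R> \<in> sym2" and orth: "\<And>\<eta>. \<eta> \<in> forms 4 \<Longrightarrow> so_trace (\<lambda>\<alpha>. \<R> (hat \<eta> \<alpha>)) = 0"
  shows "\<R> \<in> alg_curvature_operators"
proof -
  note lR = sym2_linear[OF R]
  have "so_apply (\<R> (wedge x y)) z + so_apply (\<R> (wedge y z)) x + so_apply (\<R> (wedge z x)) y = 0"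
    (is "?b x y z = 0") for x y z
  proof -
    have "?b x y z \<bullet> w = 0" for w
    proof -
      obtain \<eta> where \<eta>: "\<eta> \<in> forms 4" "hat \<eta> = wedge_product_op x y z w"
        by (rule wedge_product_op_hat)
      have "so_trace (\<lambda>\<alpha>. \<R> (wedge_product_op x y z w \<alpha>)) =
          2 * (\<R> (wedge x y) \<bullet> wedge z w + \<R> (wedge y z) \<bullet> wedge x w + \<R> (wedge z x) \<bullet> wedge y w)"
        by (simp add: wedge_product_op_def linear_add[OF lR] linear_scale[OF lR] so_trace_add
            so_trace_rank_one
            sym2_inner[OF R, of "wedge x y" "wedge z w", symmetric]
            inner_commute[of "wedge z w" "\<R> (wedge x y)"]
            sym2_inner[OF R, of "wedge y z" "wedge x w", symmetric]
            inner_commute[of "wedge x w" "\<R> (wedge y z)"]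
            sym2_inner[OF R, of "wedge z x" "wedge y w", symmetric]
            inner_commute[of "wedge y w" "\<R> (wedge z x)"])
      then show ?thesis using orth[OF \<eta>(1)] \<eta>(2) by (simp add: inner_so_wedge inner_add_left)
    qed
    then show ?thesis by (metis inner_eq_zero_iff)
  qed
  then show ?thesis using R by (simp add: alg_curvature_operators_def)
qed

text \<open>\<open>Basis\<close> turned into a finite type, so that it can index coordinate
  vectors.\<close>

typedef (overloaded) 'a basis_index = "Basis :: 'a::euclidean_space set"
  morphisms basis_vector Abs_basis_index
  using nonempty_Basis by blast

instance basis_index :: (euclidean_space) finite
proof
  have "range (basis_vector :: 'a basis_index \<Rightarrow> 'a) \<subseteq> Basis" using basis_vector by auto
  then show "finite (UNIV :: 'a basis_index set)"
    using finite_imageD[of basis_vector UNIV] finite_subset[OF _ finite_Basis]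
    by (auto simp: inj_on_def basis_vector_inject)
qed

lemma sum_basis_index: "(\<Sum>i\<in>UNIV. f (basis_vector i)) = sum f (Basis :: 'a::euclidean_space set)"
proof -
  have "inj (basis_vector :: 'a basis_index \<Rightarrow> 'a)" by (simp add: inj_on_def basis_vector_inject)
  moreover have "range basis_vector = (Basis :: 'a set)"
    using type_definition.Rep_range[OF type_definition_basis_index] .
  ultimately show ?thesis using sum.reindex[of basis_vector UNIV f] by simp
qed

text \<open>
  Operators on bivectors form no type of their own; their coefficient vectors live in a Euclidean
  space, where the separation theorem applies.
\<close>

type_synonym 'a index4 = "('a basis_index \<times> 'a basis_index) \<times> ('a basis_index \<times> 'a basis_index)"

definition index_wedge :: "'a::euclidean_space basis_index \<times> 'a basis_index \<Rightarrow> 'a so"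
  where "index_wedge i = wedge (basis_vector (fst i)) (basis_vector (snd i))"

definition op_coeffs :: "('a::euclidean_space so \<Rightarrow> 'a so) \<Rightarrow> real ^ ('a index4)"
  where "op_coeffs T = (\<chi> j. T (index_wedge (fst j)) \<bullet> index_wedge (snd j))"

text \<open>Only a left inverse of \<open>op_coeffs\<close> on linear operators: the wedges over
  ordered pairs are redundant, so not every vector is a coefficient vector. The argument and the
  value each contribute a factor 1/2.\<close>

definition op_of_coeffs :: "real ^ ('a::euclidean_space index4) \<Rightarrow> 'a so \<Rightarrow> 'a so"
  where "op_of_coeffs t \<alpha> = (1/4) *\<^sub>R (\<Sum>j\<in>UNIV. (t $ j * (\<alpha> \<bullet> index_wedge (fst j))) *\<^sub>R index_wedge (snd j))"

lemma so_expand_index: "\<alpha> = (1/2) *\<^sub>R (\<Sum>i\<in>UNIV. (\<alpha> \<bullet> index_wedge i) *\<^sub>R index_wedge i)"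
proof -
  have "(\<Sum>i\<in>UNIV. (\<alpha> \<bullet> index_wedge i) *\<^sub>R index_wedge i)
      = (\<Sum>a\<in>UNIV. \<Sum>b\<in>UNIV. (\<alpha> \<bullet> wedge (basis_vector a) (basis_vector b)) *\<^sub>R
          wedge (basis_vector a) (basis_vector b))"
    by (simp add: index_wedge_def sum.cartesian_product case_prod_beta)
  also have "\<dots> = (\<Sum>a\<in>Basis. \<Sum>b\<in>Basis. (\<alpha> \<bullet> wedge a b) *\<^sub>R wedge a b)"
    using sum_basis_index[of "\<lambda>a. \<Sum>b\<in>Basis. (\<alpha> \<bullet> wedge a b) *\<^sub>R wedge a b"]
    by (simp add: sum_basis_index[of "\<lambda>b. (\<alpha> \<bullet> wedge a b) *\<^sub>R wedge a b" for a])
  finally show ?thesis using so_expand[of \<alpha>] by simp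
qed

lemma linear_op_of_coeffs: "linear (op_of_coeffs t)"
  by (rule linearI)
    (simp_all add: op_of_coeffs_def inner_add_left distrib_left scaleR_add_left sum.distrib
      scaleR_add_right scaleR_sum_right mult_ac)

lemma op_of_coeffs_op_coeffs:
  fixes T :: "'a::euclidean_space so \<Rightarrow> 'a so"
  assumes T: "linear T"
  shows "op_of_coeffs (op_coeffs T) = T"
proof
  fix \<alpha> :: "'a so"
  have "T \<alpha> = (1/2) *\<^sub>R (\<Sum>i\<in>UNIV. (\<alpha> \<bullet> index_wedge i) *\<^sub>R T (index_wedge i))"
    by (subst so_expand_index[of \<alpha>]) (simp only: linear_scale[OF T] linear_sum[OF T])
  also have "\<dots> = (1/2) *\<^sub>R (\<Sum>i\<in>UNIV. (\<alpha> \<bullet> index_wedge i) *\<^sub>R (1/2) *\<^sub>R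
      (\<Sum>j\<in>UNIV. (T (index_wedge i) \<bullet> index_wedge j) *\<^sub>R index_wedge j))"
    by (subst so_expand_index[of "T (index_wedge i)" for i]) simp
  also have "\<dots> = op_of_coeffs (op_coeffs T) \<alpha>"
    unfolding op_of_coeffs_def op_coeffs_def UNIV_Times_UNIV[symmetric]
    by (simp add: scaleR_sum_right sum.cartesian_product case_prod_beta mult_ac)
  finally show "op_of_coeffs (op_coeffs T) \<alpha> = T \<alpha>" by simp
qed

lemma op_coeffs_cancel: "linear S \<Longrightarrow> linear T \<Longrightarrow> op_coeffs S = op_coeffs T \<Longrightarrow> S = T"
  by (metis op_of_coeffs_op_coeffs)

lemma op_coeffs_add: "op_coeffs (\<lambda>\<alpha>. S \<alpha> + T \<alpha>) = op_coeffs S + op_coeffs T"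
  by (simp add: op_coeffs_def vec_eq_iff inner_add_left)

lemma op_coeffs_scaleR: "op_coeffs (\<lambda>\<alpha>. c *\<^sub>R T \<alpha>) = c *\<^sub>R op_coeffs T"
  by (simp add: op_coeffs_def vec_eq_iff)

section \<open>The subspace of four-form operators and the compact convex set in coordinates\<close>

lemma forms_add: "\<eta> \<in> forms p \<Longrightarrow> \<zeta> \<in> forms p \<Longrightarrow> (\<lambda>X. \<eta> X + \<zeta> X) \<in> forms p"
  unfolding forms_def mem_Collect_eq
  by (intro conjI allI impI; elim conjE)
    (metis, simp add: linear_compose_add, metis add.right_neutral)

lemma forms_scaleR: "\<eta> \<in> forms p \<Longrightarrow> (\<lambda>X. c * \<eta> X) \<in> forms p"
  unfolding forms_def mem_Collect_eq
proof (elim conjE, intro conjI allI impI)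
  assume "\<forall>i<p. \<forall>X. linear (\<lambda>v. \<eta> (X(i := v)))"
  then show "linear (\<lambda>v. c * \<eta> (X(i := v)))" if "i < p" for i X
    using linear_compose_scale_right[of "\<lambda>v. \<eta> (X(i := v))" c] that by simp
next
  assume "\<forall>X Y. (\<forall>i<p. X i = Y i) \<longrightarrow> \<eta> X = \<eta> Y"
  then show "c * \<eta> X = c * \<eta> Y" if "\<forall>i<p. X i = Y i" for X Y
    using that by metis
next
  assume "\<forall>X. \<forall>i<p. \<forall>j<p. i \<noteq> j \<longrightarrow> X i = X j \<longrightarrow> \<eta> X = 0"
  then show "c * \<eta> X = 0" if "i < p" "j < p" "i \<noteq> j" "X i = X j" for X i j
    using that by (metis mult_zero_right)
qed

lemma hat_add:
  assumes "\<eta> \<in> forms 4" "\<zeta> \<in> forms 4"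
  shows "hat (\<lambda>X. \<eta> X + \<zeta> X) = (\<lambda>\<alpha>. hat \<eta> \<alpha> + hat \<zeta> \<alpha>)"
  using assms forms_add[OF assms]
  by (intro so_linear_eqI linear_compose_add)
    (simp_all add: linear_hat inner_hat_wedge inner_add_left)

lemma hat_scaleR:
  assumes "\<eta> \<in> forms 4"
  shows "hat (\<lambda>X. c * \<eta> X) = (\<lambda>\<alpha>. c *\<^sub>R hat \<eta> \<alpha>)"
  using assms forms_scaleR[OF assms]
  by (intro so_linear_eqI linear_compose_scale_right)
    (simp_all add: linear_hat inner_hat_wedge)

lemma subspace_hat_coeffs:
  "subspace ((\<lambda>\<eta>. op_coeffs (hat \<eta>)) ` (forms 4 :: ((nat \<Rightarrow> 'a::euclidean_space) \<Rightarrow> real) set))"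
    (is "subspace ?H")
proof (rule subspaceI)
  have z: "(\<lambda>X :: nat \<Rightarrow> 'a. 0) \<in> forms 4" by (simp add: forms_def linear_zero)
  have "hat (\<lambda>X :: nat \<Rightarrow> 'a. 0) = (\<lambda>\<alpha>. 0)" using hat_scaleR[OF z, of 0] by simp
  then have "op_coeffs (hat (\<lambda>X :: nat \<Rightarrow> 'a. 0)) = 0" by (simp add: op_coeffs_def vec_eq_iff)
  then show "0 \<in> ?H"
    using imageI[OF z, of "\<lambda>\<eta>. op_coeffs (hat \<eta>)"] by simp
next
  fix s t :: "real ^ 'a index4" and c :: real
  assume "s \<in> ?H"
  then obtain \<eta> where \<eta>: "\<eta> \<in> forms 4" "s = op_coeffs (hat \<eta>)" by blast
  show "c *\<^sub>R s \<in> ?H"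
    unfolding \<eta>(2) op_coeffs_scaleR[symmetric] hat_scaleR[OF \<eta>(1), symmetric]
    by (rule imageI[OF forms_scaleR[OF \<eta>(1)]])
  assume "t \<in> ?H"
  then obtain \<zeta> where \<zeta>: "\<zeta> \<in> forms 4" "t = op_coeffs (hat \<zeta>)" by blast
  show "s + t \<in> ?H"
    unfolding \<eta>(2) \<zeta>(2) op_coeffs_add[symmetric] hat_add[OF \<eta>(1) \<zeta>(1), symmetric]
    by (rule imageI[OF forms_add[OF \<eta>(1) \<zeta>(1)]])
qed

lemma continuous_on_op_of_coeffs [continuous_intros]:
  "continuous_on A f \<Longrightarrow> continuous_on A (\<lambda>t. op_of_coeffs (f t) \<alpha>)"
  unfolding op_of_coeffs_def by (intro continuous_intros)

lemma compact_bounded_trace_ops: "compact (op_coeffs ` bounded_trace_ops c t)"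
proof -
  let ?K = "bounded_trace_ops c t :: ('a::euclidean_space so \<Rightarrow> 'a so) set"
  \<comment> \<open>Closedness needs conditions on r itself rather than an image; the second
    condition says that r is a coefficient vector at all.\<close>
  have "op_coeffs ` ?K = {r. op_of_coeffs r \<in> ?K \<and> op_coeffs (op_of_coeffs r) = r}"
  proof (intro equalityI subsetI)
    fix r assume "r \<in> op_coeffs ` ?K"
    then obtain S where S: "S \<in> ?K" "r = op_coeffs S" by blast
    then have "op_of_coeffs r = S"
      using op_of_coeffs_op_coeffs[of S] by (simp add: bounded_trace_ops_def sym2_linear)
    then show "r \<in> {r. op_of_coeffs r \<in> ?K \<and> op_coeffs (op_of_coeffs r) = r}" using S by simp
  next
    fix r assume "r \<in> {r. op_of_coeffs r \<in> ?K \<and> op_coeffs (op_of_coeffs r) = r}"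
    then show "r \<in> op_coeffs ` ?K" by (metis (mono_tags, lifting) image_eqI mem_Collect_eq)
  qed
  also have "\<dots> = {r. (\<forall>\<alpha> \<beta>. op_of_coeffs r \<alpha> \<bullet> \<beta> = \<alpha> \<bullet> op_of_coeffs r \<beta>) \<and>
      (\<forall>\<alpha>. 0 \<le> op_of_coeffs r \<alpha> \<bullet> \<alpha>) \<and> (\<forall>\<alpha>. op_of_coeffs r \<alpha> \<bullet> \<alpha> \<le> c * (\<alpha> \<bullet> \<alpha>)) \<and>
      so_trace (op_of_coeffs r) = t \<and>
      (\<forall>j. op_of_coeffs r (index_wedge (fst j)) \<bullet> index_wedge (snd j) = r $ j)}"
    by (auto simp: bounded_trace_ops_def sym2_def linear_op_of_coeffs op_coeffs_def vec_eq_iff)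
  also have "closed \<dots>"
    unfolding so_trace_def
    by (intro closed_Collect_conj closed_Collect_all closed_Collect_le closed_Collect_eq continuous_intros)
      simp_all
  finally have "closed (op_coeffs ` ?K)" .
  moreover have "bounded (op_coeffs ` ?K)"
  proof -
    \<comment> \<open>Positivity at \<alpha> + \<beta> and \<alpha> - \<beta> bounds the
      off-diagonal value by the mean of the two diagonal values.\<close>
    have le: "\<bar>S \<alpha> \<bullet> \<beta>\<bar> \<le> \<bar>c\<bar>" if S: "S \<in> ?K" and n: "norm \<alpha> \<le> 1" "norm \<beta> \<le> 1" for S \<alpha> \<beta>
    proof -
      have sym: "S \<in> sym2" and pos: "\<And>\<gamma>. 0 \<le> S \<gamma> \<bullet> \<gamma>" and le: "\<And>\<gamma>. S \<gamma> \<bullet> \<gamma> \<le> c * (\<gamma> \<bullet> \<gamma>)"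
        using S by (auto simp: bounded_trace_ops_def)
      note lS = sym2_linear[OF sym]
      have c: "S \<gamma> \<bullet> \<gamma> \<le> \<bar>c\<bar>" if "norm \<gamma> \<le> 1" for \<gamma>
      proof -
        have "(norm \<gamma>)\<^sup>2 \<le> 1" using that by (simp add: power_le_one)
        then have "\<gamma> \<bullet> \<gamma> \<le> 1" by (simp add: power2_norm_eq_inner)
        then have "\<bar>c\<bar> * (\<gamma> \<bullet> \<gamma>) \<le> \<bar>c\<bar> * 1" by (intro mult_left_mono) auto
        moreover have "c * (\<gamma> \<bullet> \<gamma>) \<le> \<bar>c\<bar> * (\<gamma> \<bullet> \<gamma>)" by (intro mult_right_mono) auto
        ultimately show ?thesis using le[of \<gamma>] by simp
      qed
      have "S \<beta> \<bullet> \<alpha> = S \<alpha> \<bullet> \<beta>" using sym2_inner[OF sym, of \<beta> \<alpha>] by (simp add: inner_commute)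
      then have "0 \<le> S \<alpha> \<bullet> \<alpha> + 2 * (S \<alpha> \<bullet> \<beta>) + S \<beta> \<bullet> \<beta>" "0 \<le> S \<alpha> \<bullet> \<alpha> - 2 * (S \<alpha> \<bullet> \<beta>) + S \<beta> \<bullet> \<beta>"
        using pos[of "\<alpha> + \<beta>"] pos[of "\<alpha> - \<beta>"]
        by (simp_all add: linear_add[OF lS] linear_diff[OF lS] inner_add_left inner_add_right
            inner_diff_left inner_diff_right)
      then show ?thesis using c[OF n(1)] c[OF n(2)] by linarith
    qed
    have "norm (op_coeffs S) \<le> of_nat CARD('a index4) * \<bar>c\<bar>" if "S \<in> ?K" for S
    proof -
      have "norm (op_coeffs S) \<le> (\<Sum>j\<in>UNIV. \<bar>op_coeffs S $ j\<bar>)" by (rule norm_le_l1_cart)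
      also have "\<dots> \<le> (\<Sum>j\<in>(UNIV::'a index4 set). \<bar>c\<bar>)"
        unfolding op_coeffs_def vec_lambda_beta
        by (intro sum_mono le[OF that])
          (simp_all add: index_wedge_def norm_wedge_Basis_le basis_vector)
      finally show ?thesis by simp
    qed
    then show ?thesis by (auto simp: bounded_iff)
  qed
  ultimately show ?thesis by (simp add: compact_eq_bounded_closed)
qed

lemma convex_bounded_trace_ops: "convex (op_coeffs ` bounded_trace_ops c t)"
proof (rule convexI)
  fix x y :: "real ^ 'a index4" and u v :: real
  assume x: "x \<in> op_coeffs ` bounded_trace_ops c t" and y: "y \<in> op_coeffs ` bounded_trace_ops c t"
    and uv: "0 \<le> u" "0 \<le> v" "u + v = 1"
  obtain S T where S: "S \<in> bounded_trace_ops c t" "x = op_coeffs S"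
    and T: "T \<in> bounded_trace_ops c t" "y = op_coeffs T"
    using x y by blast
  let ?U = "\<lambda>\<alpha>. u *\<^sub>R S \<alpha> + v *\<^sub>R T \<alpha>"
  have "?U \<in> sym2" using S T by (intro sym2_add sym2_scaleR) (auto simp: bounded_trace_ops_def)
  moreover have "so_trace ?U = t"
    using S T uv(3) by (simp add: bounded_trace_ops_def so_trace_add so_trace_scaleR flip: distrib_right)
  moreover have "0 \<le> ?U \<alpha> \<bullet> \<alpha>" for \<alpha>
    using S T uv by (simp add: bounded_trace_ops_def inner_add_left)
  moreover have "?U \<alpha> \<bullet> \<alpha> \<le> c * (\<alpha> \<bullet> \<alpha>)" for \<alpha>
  proof -
    have "u * (S \<alpha> \<bullet> \<alpha>) + v * (T \<alpha> \<bullet> \<alpha>) \<le> u * (c * (\<alpha> \<bullet> \<alpha>)) + v * (c * (\<alpha> \<bullet> \<alpha>))"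
      using S T uv by (intro add_mono mult_left_mono) (auto simp: bounded_trace_ops_def)
    also have "\<dots> = c * (\<alpha> \<bullet> \<alpha>)" using uv(3) by (simp flip: distrib_right)
    finally show ?thesis by (simp add: inner_add_left)
  qed
  ultimately have "?U \<in> bounded_trace_ops c t" by (simp add: bounded_trace_ops_def)
  moreover have "op_coeffs ?U = u *\<^sub>R x + v *\<^sub>R y"
    by (simp add: S T op_coeffs_add op_coeffs_scaleR)
  ultimately show "u *\<^sub>R x + v *\<^sub>R y \<in> op_coeffs ` bounded_trace_ops c t" by (metis (no_types, lifting) imageI)
qed

lemma linear_rank_one: "linear (\<lambda>\<alpha>. (\<alpha> \<bullet> v) *\<^sub>R w)"
  by (rule linearI) (simp_all add: inner_add_left scaleR_add_left)

text \<open>The rank-one operators weighted by r represent the functional; symmetrising them makes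
  \<R> self-adjoint and leaves the pairing with self-adjoint S unchanged.\<close>

lemma coeff_functional_riesz:
  fixes r :: "real ^ ('a::euclidean_space index4)"
  obtains \<R> where "\<R> \<in> sym2" "\<And>S. S \<in> sym2 \<Longrightarrow> so_trace (\<lambda>\<alpha>. \<R> (S \<alpha>)) = r \<bullet> op_coeffs S"
proof
  let ?v = "\<lambda>j::'a index4. index_wedge (fst j)" and ?w = "\<lambda>j::'a index4. index_wedge (snd j)"
  let ?R = "\<lambda>\<alpha>. \<Sum>j\<in>UNIV. (r $ j / 2) *\<^sub>R ((\<alpha> \<bullet> ?v j) *\<^sub>R ?w j + (\<alpha> \<bullet> ?w j) *\<^sub>R ?v j)"
  have "linear ?R"
    by (intro linear_compose_sum ballI linear_compose_scale_right linear_compose_add linear_rank_one)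
  moreover have "?R \<alpha> \<bullet> \<beta> = \<alpha> \<bullet> ?R \<beta>" for \<alpha> \<beta>
    unfolding inner_sum_left inner_sum_right
    by (intro sum.cong refl)
      (simp add: inner_add_left inner_add_right inner_commute algebra_simps)
  ultimately show "?R \<in> sym2" by (simp add: sym2_def)
  show "so_trace (\<lambda>\<alpha>. ?R (S \<alpha>)) = r \<bullet> op_coeffs S" if S: "S \<in> sym2" for S
  proof -
    have "so_trace (\<lambda>\<alpha>. ?R (S \<alpha>)) = (\<Sum>j\<in>UNIV. r $ j / 2 * (S (?v j) \<bullet> ?w j + S (?w j) \<bullet> ?v j))"
      by (simp only: so_trace_sum so_trace_scaleR so_trace_add so_trace_rank_one sym2_inner[OF S])
    also have "\<dots> = (\<Sum>j\<in>UNIV. r $ j * (S (?v j) \<bullet> ?w j))"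
    proof (intro sum.cong refl)
      fix j
      have "S (?w j) \<bullet> ?v j = S (?v j) \<bullet> ?w j"
        by (subst sym2_inner[OF S]) (rule inner_commute)
      then show "r $ j / 2 * (S (?v j) \<bullet> ?w j + S (?w j) \<bullet> ?v j) = r $ j * (S (?v j) \<bullet> ?w j)"
        by simp
    qed
    finally show ?thesis by (simp add: inner_vec_def op_coeffs_def)
  qed
qed

text \<open>Instead of separating an affine space from K, the point A is separated from K plus the
  subspace of four-form operators, a convex set that is closed as the sum of a compact and a closed
  set.\<close>

lemma separation_by_alg_curvature:
  fixes A :: "'a::euclidean_space so \<Rightarrow> 'a so"
  assumes A: "A \<in> sym2" and ne: "(bounded_trace_ops c t :: ('a so \<Rightarrow> 'a so) set) \<noteq> {}"
    and no: "\<And>\<eta>. \<eta> \<in> forms 4 \<Longrightarrow> (\<lambda>\<alpha>. A \<alpha> + hat \<eta> \<alpha>) \<notin> bounded_trace_ops c t"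
  obtains \<R> where "\<R> \<in> alg_curvature_operators"
    "\<And>S. S \<in> bounded_trace_ops c t \<Longrightarrow> so_trace (\<lambda>\<alpha>. \<R> (A \<alpha>)) < so_trace (\<lambda>\<alpha>. \<R> (S \<alpha>))"
proof -
  let ?K = "op_coeffs ` (bounded_trace_ops c t :: ('a so \<Rightarrow> 'a so) set)"
  let ?H = "(\<lambda>\<eta>. op_coeffs (hat \<eta>)) ` (forms 4 :: ((nat \<Rightarrow> 'a) \<Rightarrow> real) set)"
  let ?C = "\<Union>x\<in>?K. \<Union>y\<in>?H. {x + y}"
  have cl: "closed ?C"
    by (rule compact_closed_sums[OF compact_bounded_trace_ops closed_subspace[OF subspace_hat_coeffs]])
  have cv: "convex ?C"
    by (rule convex_sums[OF convex_bounded_trace_ops subspace_imp_convex[OF subspace_hat_coeffs]])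
  have out: "op_coeffs A \<notin> ?C"
  proof
    assume "op_coeffs A \<in> ?C"
    then obtain S \<eta> where S: "S \<in> bounded_trace_ops c t" and \<eta>: "\<eta> \<in> forms 4"
      and eq: "op_coeffs A = op_coeffs S + op_coeffs (hat \<eta>)" by blast
    have S2: "S \<in> sym2" using S by (simp add: bounded_trace_ops_def)
    have "A = (\<lambda>\<alpha>. S \<alpha> + hat \<eta> \<alpha>)"
      using A S2 \<eta> eq by (intro op_coeffs_cancel linear_compose_add) (auto simp: op_coeffs_add sym2_linear linear_hat)
    then have "(\<lambda>\<alpha>. A \<alpha> + hat (\<lambda>X. (-1) * \<eta> X) \<alpha>) = S"
      unfolding hat_scaleR[OF \<eta>] by auto
    then show False using no[OF forms_scaleR[OF \<eta>, of "-1"]] S by simp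
  qed
  from separating_hyperplane_closed_point[OF cv cl out]
  obtain r b where rb: "r \<bullet> op_coeffs A < b" "\<forall>x\<in>?C. b < r \<bullet> x"
    by (elim exE conjE)
  have sep: "b < r \<bullet> op_coeffs S + r \<bullet> h" if "S \<in> bounded_trace_ops c t" "h \<in> ?H" for S h
  proof -
    have "op_coeffs S + h \<in> ?C" using that by blast
    from rb(2)[rule_format, OF this] show ?thesis by (simp only: inner_add_right)
  qed
  have r0: "r \<bullet> h = 0" if h: "h \<in> ?H" for h
  proof (rule ccontr)
    assume nz: "r \<bullet> h \<noteq> 0"
    obtain S where S: "S \<in> (bounded_trace_ops c t :: ('a so \<Rightarrow> 'a so) set)" using ne by blast
    \<comment> \<open>The scalar is chosen so that the separation inequality at this multiple of h
      reads b < b.\<close>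
    have "((b - r \<bullet> op_coeffs S) / (r \<bullet> h)) *\<^sub>R h \<in> ?H"
      by (rule subspace_scale[OF subspace_hat_coeffs h])
    from sep[OF S this] show False using nz by simp
  qed
  obtain \<R> where R: "\<R> \<in> sym2" and tr: "\<And>S. S \<in> sym2 \<Longrightarrow> so_trace (\<lambda>\<alpha>. \<R> (S \<alpha>)) = r \<bullet> op_coeffs S"
    using coeff_functional_riesz[of r] by metis
  have "\<R> \<in> alg_curvature_operators"
    using R by (rule hat_orthogonal_imp_alg_curvature) (simp add: tr hat_in_sym2 r0)
  moreover have "so_trace (\<lambda>\<alpha>. \<R> (A \<alpha>)) < so_trace (\<lambda>\<alpha>. \<R> (S \<alpha>))" if S: "S \<in> bounded_trace_ops c t" for S
  proof -
    have "S \<in> sym2" using S by (simp add: bounded_trace_ops_def)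
    moreover have "b < r \<bullet> op_coeffs S"
      using sep[OF S subspace_0[OF subspace_hat_coeffs]] by simp
    ultimately show ?thesis using rb(1) A by (simp add: tr)
  qed
  ultimately show thesis using that by blast
qed

text \<open>The equivalence for a single form \<omega>; here t is the trace of
  \<open>action_op p \<omega>\<close>.\<close>

lemma curvature_bound_iff:
  fixes \<omega> :: "(nat \<Rightarrow> 'a::euclidean_space) \<Rightarrow> real"
  assumes "p \<le> DIM('a)" and k: "1 \<le> k" "k \<le> real (DIM('a) choose 2)" and \<omega>: "\<omega> \<in> forms p"
  defines "t \<equiv> real p * (real DIM('a) - real p) * form_inner p \<omega> \<omega>"
  shows "(\<forall>\<R>\<in>alg_curvature_operators. lowest_eigenvalue_sum k \<R> \<ge> k * \<kappa> \<longrightarrow>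
        form_inner p (Ric_L p \<R> \<omega>) \<omega> \<ge> \<kappa> * t)
     \<longleftrightarrow> (\<exists>\<eta>\<in>forms 4. (\<lambda>\<alpha>. action_op p \<omega> \<alpha> + hat \<eta> \<alpha>) \<in> bounded_trace_ops (t / k) t)"
    (is "?a \<longleftrightarrow> ?b")
proof -
  have k0: "0 \<le> k" "k \<noteq> 0" using k by auto
  \<comment> \<open>With c = t / k, the trace c k in the minimization lemmas is t.\<close>
  have ck: "t / k * k = t" using k0 by simp
  have "0 \<le> form_inner p \<omega> \<omega>" by (simp add: form_inner_def sum_nonneg)
  then have "0 \<le> t" unfolding t_def using assms(1) by (intro mult_nonneg_nonneg) simp_all
  then have t0: "0 \<le> t / k" using k0 by (intro divide_nonneg_nonneg)
  have sym: "\<R> \<in> sym2" if "\<R> \<in> alg_curvature_operators" for \<R> :: "'a so \<Rightarrow> 'a so"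
    using that by (simp add: alg_curvature_operators_def)
  show ?thesis
  proof
    assume ?b
    then obtain \<eta> where \<eta>: "\<eta> \<in> forms 4"
      and S: "(\<lambda>\<alpha>. action_op p \<omega> \<alpha> + hat \<eta> \<alpha>) \<in> bounded_trace_ops (t / k) (t / k * k)"
      unfolding ck by blast
    show ?a
    proof (intro ballI impI)
      fix \<R> :: "'a so \<Rightarrow> 'a so"
      assume R: "\<R> \<in> alg_curvature_operators" and low: "lowest_eigenvalue_sum k \<R> \<ge> k * \<kappa>"
      note lR = sym2_linear[OF sym[OF R]]
      have "\<kappa> * t = t / k * (k * \<kappa>)" using k0 by simp
      also have "\<dots> \<le> t / k * lowest_eigenvalue_sum k \<R>"
        using low t0 by (rule mult_left_mono)
      also have "\<dots> \<le> so_trace (\<lambda>\<alpha>. \<R> (action_op p \<omega> \<alpha> + hat \<eta> \<alpha>))"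
        by (rule bounded_trace_ops_lower_bound[OF sym[OF R] S k0(1) k(2)])
      also have "\<dots> = form_inner p (Ric_L p \<R> \<omega>) \<omega>"
        by (simp add: linear_add[OF lR] so_trace_add so_trace_alg_curvature_hat[OF \<eta> R]
            form_inner_Ric_L_trace[OF \<omega> sym[OF R]])
      finally show "form_inner p (Ric_L p \<R> \<omega>) \<omega> \<ge> \<kappa> * t" .
    qed
  next
    assume a: ?a
    show ?b
    proof (rule ccontr)
      assume "\<not> ?b"
      then have no: "(\<lambda>\<alpha>. action_op p \<omega> \<alpha> + hat \<eta> \<alpha>) \<notin> bounded_trace_ops (t / k) t"
        if "\<eta> \<in> forms 4" for \<eta> using that by blast
      note minimizer = bounded_trace_ops_minimizer[OF _ t0 k0(1) k(2), unfolded ck]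
      have ne: "bounded_trace_ops (t / k) t \<noteq> ({} :: ('a so \<Rightarrow> 'a so) set)"
        using minimizer[OF sym[OF id_alg_curvature]] by blast
      obtain \<R> where R: "\<R> \<in> alg_curvature_operators"
        and less: "\<And>S. S \<in> bounded_trace_ops (t / k) t \<Longrightarrow>
          so_trace (\<lambda>\<alpha>. \<R> (action_op p \<omega> \<alpha>)) < so_trace (\<lambda>\<alpha>. \<R> (S \<alpha>))"
        using separation_by_alg_curvature[OF action_op_in_sym2[OF \<omega>] ne no] by metis
      define L where "L = lowest_eigenvalue_sum k \<R>"
      obtain S where "S \<in> bounded_trace_ops (t / k) t" "so_trace (\<lambda>\<alpha>. \<R> (S \<alpha>)) = t / k * L"
        using minimizer[OF sym[OF R]] unfolding L_def by blast
      then have lt: "so_trace (\<lambda>\<alpha>. \<R> (action_op p \<omega> \<alpha>)) < t / k * L" using less by metis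
      \<comment> \<open>The shift brings the sum of the k lowest eigenvalues from L to exactly k
        \<kappa>, so (a) applies. It adds d t to the Ricci term, which by the strict separation
        stays below t L / k + d t = \<kappa> t.\<close>
      define d where "d = \<kappa> - L / k"
      let ?R = "\<lambda>\<alpha>. \<R> \<alpha> + d *\<^sub>R \<alpha>"
      have R': "?R \<in> alg_curvature_operators" by (rule alg_curvature_shift[OF R])
      have "lowest_eigenvalue_sum k ?R = k * \<kappa>"
        unfolding lowest_eigenvalue_sum_shift[OF sym[OF R] k0(1) k(2)] L_def[symmetric] d_def
        using k0 by (simp add: algebra_simps)
      then have "\<kappa> * t \<le> form_inner p (Ric_L p ?R \<omega>) \<omega>" using a R' by auto
      also have "\<dots> = so_trace (\<lambda>\<alpha>. \<R> (action_op p \<omega> \<alpha>)) + d * t"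
        by (simp add: form_inner_Ric_L_trace[OF \<omega> sym[OF R']] so_trace_add so_trace_scaleR
            so_trace_action_op[OF \<omega>] t_def)
      also have "\<dots> < t / k * L + d * t" using lt by simp
      also have "\<dots> = \<kappa> * t" using k0 by (simp add: d_def algebra_simps)
      finally show False by simp
    qed
  qed
qed

theorem theorem2p7:
  fixes p :: nat and k \<kappa> :: real
  assumes "1 \<le> p" and "p \<le> DIM('a::euclidean_space)"
    and "1 \<le> k" and "k \<le> real (DIM('a) choose 2)"
  shows
    "(\<forall>\<R> \<in> (alg_curvature_operators :: ('a so \<Rightarrow> 'a so) set).
        lowest_eigenvalue_sum k \<R> \<ge> k * \<kappa> \<longrightarrow>
        (\<forall>\<omega> \<in> forms p.
          form_inner p (Ric_L p \<R> \<omega>) \<omega>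
            \<ge> \<kappa> * (real p * (real DIM('a) - real p)) * form_inner p \<omega> \<omega>))
     \<longleftrightarrow>
     (\<forall>\<omega> \<in> (forms p :: ((nat \<Rightarrow> 'a) \<Rightarrow> real) set). \<exists>\<eta> \<in> forms 4.
        let S = (\<lambda>\<alpha>. action_op p \<omega> \<alpha> + hat \<eta> \<alpha>) in
        op_le (\<lambda>\<alpha>. 0) S \<and>
        op_le S (\<lambda>\<alpha>. (so_trace S / k) *\<^sub>R \<alpha>) \<and>
        (\<lambda>\<alpha>. (so_trace S / k) *\<^sub>R \<alpha>) =
          (\<lambda>\<alpha>. (real p * (real DIM('a) - real p) / k * form_inner p \<omega> \<omega>) *\<^sub>R \<alpha>))"
proof -
  define t where "t \<omega> = real p * (real DIM('a) - real p) * form_inner p \<omega> \<omega>"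
    for \<omega> :: "(nat \<Rightarrow> 'a) \<Rightarrow> real"
  have eq: "(let S = (\<lambda>\<alpha>. action_op p \<omega> \<alpha> + hat \<eta> \<alpha>) in
        op_le (\<lambda>\<alpha>. 0) S \<and>
        op_le S (\<lambda>\<alpha>. (so_trace S / k) *\<^sub>R \<alpha>) \<and>
        (\<lambda>\<alpha>. (so_trace S / k) *\<^sub>R \<alpha>) =
          (\<lambda>\<alpha>. (real p * (real DIM('a) - real p) / k * form_inner p \<omega> \<omega>) *\<^sub>R \<alpha>))
      \<longleftrightarrow> (\<lambda>\<alpha>. action_op p \<omega> \<alpha> + hat \<eta> \<alpha>) \<in> bounded_trace_ops (t \<omega> / k) (t \<omega>)"
    if \<omega>: "\<omega> \<in> forms p" and \<eta>: "\<eta> \<in> forms 4" for \<omega> \<eta> :: "(nat \<Rightarrow> 'a) \<Rightarrow> real"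
  proof -
    \<comment> \<open>With the trace known for every \<eta>, the equality of operators in (b) holds
      and the two inequalities become membership in the set with c = t / k.\<close>
    have "so_trace (\<lambda>\<alpha>. action_op p \<omega> \<alpha> + hat \<eta> \<alpha>) = t \<omega>"
      by (simp add: so_trace_add so_trace_action_op[OF \<omega>] so_trace_hat[OF \<eta>] t_def)
    then show ?thesis
      using sym2_add[OF action_op_in_sym2[OF \<omega>] hat_in_sym2[OF \<eta>]]
      by (simp add: Let_def op_le_def bounded_trace_ops_def) (simp add: t_def)
  qed
  have "(\<forall>\<R> \<in> (alg_curvature_operators :: ('a so \<Rightarrow> 'a so) set).
        lowest_eigenvalue_sum k \<R> \<ge> k * \<kappa> \<longrightarrow>
        (\<forall>\<omega> \<in> forms p. form_inner p (Ric_L p \<R> \<omega>) \<omega>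
            \<ge> \<kappa> * (real p * (real DIM('a) - real p)) * form_inner p \<omega> \<omega>))
      \<longleftrightarrow> (\<forall>\<omega> \<in> forms p. \<forall>\<R> \<in> (alg_curvature_operators :: ('a so \<Rightarrow> 'a so) set).
        lowest_eigenvalue_sum k \<R> \<ge> k * \<kappa> \<longrightarrow> form_inner p (Ric_L p \<R> \<omega>) \<omega> \<ge> \<kappa> * t \<omega>)"
    unfolding t_def mult.assoc by blast
  also have "\<dots> \<longleftrightarrow> (\<forall>\<omega> \<in> forms p. \<exists>\<eta> \<in> forms 4.
      (\<lambda>\<alpha>. action_op p \<omega> \<alpha> + hat \<eta> \<alpha>) \<in> bounded_trace_ops (t \<omega> / k) (t \<omega>))"
    unfolding t_def by (intro ball_cong refl curvature_bound_iff assms)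
  finally show ?thesis by (rule trans) (intro ball_cong bex_cong refl eq[symmetric])
qed

end
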